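(* Let $f_1$ and $f_2$ be two post-critically finite monic polynomials on $\mathbb{C}$ of the same degree $d\ge2$, and let $F$ be their formal mating (a degree $d$ branched covering of a topological sphere). Then the iterated monodromy group of $F$, viewed as a group of automorphisms of the tree of preimages of a base point, contains a tree automorphism which acts as a cyclic permutation of order $d^n$ on the $n$-th level for every $n\ge1$.
   Context: Formal mating: let $\mathbb{C}_1,\mathbb{C}_2$ be two copies of $\mathbb{C}$, with $f_i$ acting on $\mathbb{C}_i$. Compactify each by a circle at infinity: $\widetilde{\mathbb{C}_i}=\mathbb{C}_i\cup\{\infty\cdot e^{2i\pi\theta}: \theta\in\mathbb{R}/\mathbb{Z}\}$, and extend $f_i$ continuously by $\infty\cdot e^{2i\pi\theta}\mapsto\infty\cdot e^{2i\pi d\theta}$. Glue $\widetilde{\mathbb{C}_1}$ and $\widetilde{\mathbb{C}_2}$ by identifying $\infty\cdot e^{2i\pi\theta}\in\widetilde{\mathbb{C}_1}$ with $\infty\cdot e^{-2i\pi\theta}\in\widetilde{\mathbb{C}_2}$. The result is a topological sphere $S$, and $f_1,f_2$ together define a degree $d$ branched covering $F:S\to S$ whose restrictions to the hemispheres $\mathbb{C}_1$ and $\mathbb{C}_2$ are $f_1$ and $f_2$; $F$ is the formal mating. A polynomial is post-critically finite if the union over $n\ge1$ of the images under its $n$-th iterate of its critical points in $\mathbb{C}$ is finite. If $f_1,f_2$ are post-critically finite then so is $F$, i.e. $P_F=\bigcup_{n\ge1}F^n(\text{critical points of }F)$ is finite. Iterated monodromy group: $F$ restricts to a degree $d$ covering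 $F:S\setminus F^{-1}(P_F)\to S\setminus P_F$. For a base point $t\in S\setminus P_F$, the tree of preimages $T(F,t)$ is the rooted tree with root $t$, vertex set the abstract disjoint union $\bigsqcup_{n\ge0}F^{-n}(t)$, edges $\{F(x),x\}$ for $F(x)\in F^{-n}(t)$, $x\in F^{-(n+1)}(t)$, $n\ge 0$; its $n$-th level is $F^{-n}(t)$, which has $d^n$ elements. The group $\pi_1(S\setminus P_F,t)$ acts on $T(F,t)$ by tree automorphisms: $[\gamma]x$ is the terminal point of the $F^n$-lift of $\gamma$ starting at $x\in F^{-n}(t)$. The iterated monodromy group $\mathrm{IMG}(F,t)$ is the quotient of $\pi_1(S\setminus P_F,t)$ by the kernel of this action, equivalently the image of $\pi_1(S\setminus P_F,t)$ in $\mathrm{Aut}(T(F,t))$. Up to isomorphism (of groups acting on rooted trees) it does not depend on $t$. "Acts as a cyclic permutation of order $d^n$ on the $n$-th level" means that the induced permutation of the $d^n$ vertices of level $n$ is a single cycle of length $d^n$. *)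

theory Defs
  imports
    "HOL-Analysis.Analysis"
    "HOL-Computational_Algebra.Polynomial"
    "HOL-Combinatorics.Orbits"
    "HOL-Algebra.Bij"
begin

section \<open>The complex plane compactified by a circle at infinity\<close>

text \<open>The unit complex number \<open>exp (2 * pi * \<i> * \<theta>)\<close> stands for the angle
  \<open>\<theta> \<in> \<real>/\<int>\<close>; multiplying the angle by \<open>d\<close> is taking the \<open>d\<close>-th power and negating it
  is complex conjugation.\<close>

typedef circle = "sphere (0::complex) 1"
  morphisms circle_val Abs_circle
  by (rule exI[of _ 1]) simp

setup_lifting type_definition_circle

lift_definition circle_power :: "circle \<Rightarrow> nat \<Rightarrow> circle" is "\<lambda>u n. u ^ n"
  by (simp add: norm_power)

lift_definition circle_cnj :: "circle \<Rightarrow> circle" is cnj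
  by simp

lemma circle_cnj_cnj [simp]: "circle_cnj (circle_cnj u) = u"
  by transfer simp

lemma circle_cnj_power: "circle_cnj (circle_power u n) = circle_power (circle_cnj u) n"
  by transfer simp

datatype compact_plane = Finite complex | Infinity circle

text \<open>The topology is the one transported from the closed unit disc along the radial bijection
  below: neighbourhoods of \<open>Infinity u\<close> contain truncated sectors around the direction \<open>u\<close>.\<close>

fun to_disc :: "compact_plane \<Rightarrow> complex" where
  "to_disc (Finite z) = z / of_real (1 + norm z)"
| "to_disc (Infinity u) = circle_val u"

lemma norm_to_disc_Finite: "norm (to_disc (Finite z)) = norm z / (1 + norm z)"
proof -
  have "norm (complex_of_real (1 + norm z)) = 1 + norm z"
    by (metis abs_of_nonneg add_nonneg_nonneg norm_ge_zero norm_of_real zero_le_one)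
  then show ?thesis by (simp add: norm_divide del: of_real_add)
qed

lemma bij_betw_to_disc: "bij_betw to_disc UNIV (cball 0 1)"
proof -
  have fin_lt: "norm (to_disc (Finite z)) < 1" for z
    unfolding norm_to_disc_Finite by (simp add: divide_less_eq add_pos_nonneg)
  have inf_eq: "norm (circle_val u) = 1" for u
    using circle_val[of u] by simp
  have fin_inj: "z = w" if eq: "to_disc (Finite z) = to_disc (Finite w)" for z w
  proof -
    have "norm z / (1 + norm z) = norm w / (1 + norm w)"
      using arg_cong[OF eq, of norm] unfolding norm_to_disc_Finite .
    moreover have "1 + norm z \<noteq> 0" "1 + norm w \<noteq> 0"
      by (smt (verit) norm_ge_zero)+
    ultimately have n: "norm z = norm w"
      by (simp add: divide_simps algebra_simps)
    have "complex_of_real (1 + norm w) \<noteq> 0"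
      by (smt (verit) norm_ge_zero of_real_eq_0_iff)
    then show ?thesis using eq n by simp
  qed
  have "inj to_disc"
  proof (rule injI)
    fix x y assume eq: "to_disc x = to_disc y"
    show "x = y"
    proof (cases x; cases y)
      fix z w assume "x = Finite z" "y = Finite w"
      then show ?thesis using eq fin_inj by blast
    next
      fix z u assume "x = Finite z" "y = Infinity u"
      then show ?thesis using eq fin_lt[of z] inf_eq[of u] by simp
    next
      fix z u assume "x = Infinity u" "y = Finite z"
      then show ?thesis using eq fin_lt[of z] inf_eq[of u] by simp
    next
      fix u v assume "x = Infinity u" "y = Infinity v"
      then show ?thesis using eq by (simp add: circle_val_inject)
    qed
  qed
  moreover have "w \<in> range to_disc" if "w \<in> cball 0 1" for w
  proof (cases "norm w = 1")
    case True
    then have "to_disc (Infinity (Abs_circle w)) = w"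
      by (simp add: Abs_circle_inverse)
    then show ?thesis by (metis rangeI)
  next
    case False
    then have lt: "norm w < 1" using that by simp
    define a where "a = 1 - norm w"
    have a: "a > 0" "a \<le> 1" using lt by (auto simp: a_def)
    have "norm (w / of_real a) = norm w / a"
      using a by (simp add: norm_divide)
    then have "1 + norm (w / of_real a) = 1 / a"
      using a by (simp add: a_def field_simps)
    then have "to_disc (Finite (w / of_real a)) = w"
      using a by simp
    then show ?thesis by (metis rangeI)
  qed
  moreover have "to_disc x \<in> cball 0 1" for x
  proof (cases x)
    case (Finite z)
    then show ?thesis using fin_lt[of z] by simp
  next
    case (Infinity u)
    then show ?thesis by (simp add: inf_eq)
  qed
  ultimately show ?thesis by (auto simp: bij_betw_def)
qed

instantiation compact_plane :: topological_space
begin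

definition open_compact_plane :: "compact_plane set \<Rightarrow> bool" where
  "open_compact_plane U \<longleftrightarrow> (\<exists>V. open V \<and> U = to_disc -` V)"

instance
proof
  show "open (UNIV :: compact_plane set)"
    unfolding open_compact_plane_def by (intro exI[of _ UNIV]) simp
  fix S T :: "compact_plane set"
  assume "open S" "open T"
  then obtain V W where "open V" "open W" "S = to_disc -` V" "T = to_disc -` W"
    unfolding open_compact_plane_def by blast
  then show "open (S \<inter> T)"
    unfolding open_compact_plane_def by (intro exI[of _ "V \<inter> W"]) auto
next
  fix K :: "compact_plane set set"
  assume "\<forall>S\<in>K. open S"
  then obtain V where "\<And>S. S \<in> K \<Longrightarrow> open (V S) \<and> S = to_disc -` V S"
    unfolding open_compact_plane_def by metis
  then show "open (\<Union>K)"
    unfolding open_compact_plane_def by (intro exI[of _ "\<Union>(V ` K)"]) blast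
qed

end

text \<open>For a monic polynomial of degree \<open>d \<ge> 1\<close> this is the continuous extension.\<close>

fun extend_poly :: "nat \<Rightarrow> complex poly \<Rightarrow> compact_plane \<Rightarrow> compact_plane" where
  "extend_poly d f (Finite z) = Finite (poly f z)"
| "extend_poly d f (Infinity u) = Infinity (circle_power u d)"

section \<open>The sphere and the formal mating\<close>

definition glue :: "compact_plane + compact_plane \<Rightarrow> compact_plane + compact_plane \<Rightarrow> bool" where
  "glue x y \<longleftrightarrow> x = y \<or>
     (\<exists>u. x = Inl (Infinity u) \<and> y = Inr (Infinity (circle_cnj u))) \<or>
     (\<exists>u. x = Inr (Infinity (circle_cnj u)) \<and> y = Inl (Infinity u))"

lemma equivp_glue: "equivp glue"
proof (rule equivpI)
  show "reflp glue" by (simp add: reflp_def glue_def)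
  show "symp glue" by (auto simp: symp_def glue_def)
  show "transp glue"
    unfolding transp_def glue_def by (metis Inl_Inr_False circle_cnj_cnj compact_plane.inject(2)
      sum.inject)
qed

quotient_type mating_sphere = "compact_plane + compact_plane" / glue
  by (rule equivp_glue)

text \<open>Quotient topology of the disjoint union: a set is open iff its preimages in both copies are.\<close>

instantiation mating_sphere :: topological_space
begin

definition open_mating_sphere :: "mating_sphere set \<Rightarrow> bool" where
  "open_mating_sphere U \<longleftrightarrow>
     open ((\<lambda>x. abs_mating_sphere (Inl x)) -` U) \<and> open ((\<lambda>x. abs_mating_sphere (Inr x)) -` U)"

instance
  by standard (auto simp: open_mating_sphere_def vimage_Union)

end

lift_definition formal_mating ::
    "nat \<Rightarrow> complex poly \<Rightarrow> complex poly \<Rightarrow> mating_sphere \<Rightarrow> mating_sphere"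
  is "\<lambda>d f1 f2. map_sum (extend_poly d f1) (extend_poly d f2)"
  by (auto simp: glue_def circle_cnj_power)

section \<open>Critical points and post-critical finiteness\<close>

definition post_critically_finite :: "complex poly \<Rightarrow> bool" where
  "post_critically_finite f \<longleftrightarrow>
     finite (\<Union>n\<in>{1..}. (poly f ^^ n) ` {z. poly (pderiv f) z = 0})"

text \<open>The critical points of a branched covering are the points of local degree greater than 1,
  that is, those at which the map is not locally injective.\<close>

definition critical_points :: "('a::topological_space \<Rightarrow> 'a) \<Rightarrow> 'a set" where
  "critical_points F = {x. \<not> (\<exists>U. open U \<and> x \<in> U \<and> inj_on F U)}"

definition post_critical_set :: "('a::topological_space \<Rightarrow> 'a) \<Rightarrow> 'a set" where
  "post_critical_set F = (\<Union>n\<in>{1..}. (F ^^ n) ` critical_points F)"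

section \<open>The tree of preimages\<close>

definition tree_level :: "('a \<Rightarrow> 'a) \<Rightarrow> 'a \<Rightarrow> nat \<Rightarrow> (nat \<times> 'a) set" where
  "tree_level F t n = {n} \<times> {x. (F ^^ n) x = t}"

definition tree_vertices :: "('a \<Rightarrow> 'a) \<Rightarrow> 'a \<Rightarrow> (nat \<times> 'a) set" where
  "tree_vertices F t = (\<Union>n. tree_level F t n)"

definition tree_edges :: "('a \<Rightarrow> 'a) \<Rightarrow> 'a \<Rightarrow> (nat \<times> 'a) set set" where
  "tree_edges F t = {{(n, F x), (Suc n, x)} | n x. (F ^^ Suc n) x = t}"

definition tree_automorphisms :: "('a \<Rightarrow> 'a) \<Rightarrow> 'a \<Rightarrow> (nat \<times> 'a \<Rightarrow> nat \<times> 'a) set" where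
  "tree_automorphisms F t =
     {h \<in> Bij (tree_vertices F t). h (0, t) = (0, t) \<and>
        (\<forall>v\<in>tree_vertices F t. \<forall>w\<in>tree_vertices F t.
           {v, w} \<in> tree_edges F t \<longleftrightarrow> {h v, h w} \<in> tree_edges F t)}"

definition tree_Aut :: "('a \<Rightarrow> 'a) \<Rightarrow> 'a \<Rightarrow> (nat \<times> 'a \<Rightarrow> nat \<times> 'a) monoid" where
  "tree_Aut F t = (BijGroup (tree_vertices F t))\<lparr>carrier := tree_automorphisms F t\<rparr>"

section \<open>The iterated monodromy group\<close>

definition loops :: "'a::topological_space set \<Rightarrow> 'a \<Rightarrow> (real \<Rightarrow> 'a) set" where
  "loops A t = {\<gamma>. path \<gamma> \<and> path_image \<gamma> \<subseteq> A \<and> pathstart \<gamma> = t \<and> pathfinish \<gamma> = t}"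

text \<open>The elements of the fundamental group: homotopy classes, with fixed end points, of loops.\<close>

definition pi1 :: "'a::topological_space set \<Rightarrow> 'a \<Rightarrow> (real \<Rightarrow> 'a) set set" where
  "pi1 A t = loops A t // {(\<gamma>, \<gamma>'). \<gamma> \<in> loops A t \<and> \<gamma>' \<in> loops A t \<and> homotopic_paths A \<gamma> \<gamma>'}"

text \<open>A path whose image under \<open>F ^^ n\<close> is a loop in the complement of the post-critical set
  automatically stays in the domain of the covering induced by \<open>F ^^ n\<close>.\<close>

definition is_lift :: "('a::topological_space \<Rightarrow> 'a) \<Rightarrow> nat \<Rightarrow> (real \<Rightarrow> 'a) \<Rightarrow> (real \<Rightarrow> 'a) \<Rightarrow> bool" where
  "is_lift F n \<gamma> \<delta> \<longleftrightarrow> path \<delta> \<and> (\<forall>s\<in>{0..1}. (F ^^ n) (\<delta> s) = \<gamma> s)"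

definition monodromy ::
    "('a::topological_space \<Rightarrow> 'a) \<Rightarrow> 'a \<Rightarrow> (real \<Rightarrow> 'a) set \<Rightarrow> nat \<times> 'a \<Rightarrow> nat \<times> 'a" where
  "monodromy F t c =
     (\<lambda>(n, x)\<in>tree_vertices F t.
        (n, THE y. \<exists>\<gamma>\<in>c. \<exists>\<delta>. is_lift F n \<gamma> \<delta> \<and> pathstart \<delta> = x \<and> pathfinish \<delta> = y))"

text \<open>The image of the fundamental group, with the group operation of \<open>tree_Aut F t\<close>.\<close>

definition IMG :: "('a::topological_space \<Rightarrow> 'a) \<Rightarrow> 'a \<Rightarrow> (nat \<times> 'a \<Rightarrow> nat \<times> 'a) monoid" where
  "IMG F t = (tree_Aut F t)\<lparr>carrier := monodromy F t ` pi1 (- post_critical_set F) t\<rparr>"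

end

theory Submission
  imports
    Defs
    "HOL-Complex_Analysis.Conformal_Mappings"
    "HOL-Computational_Algebra.Fundamental_Theorem_Algebra"
begin

text \<open>The automorphism is the monodromy of the equator of the sphere, the common circle at infinity of
the two planes. Near every point of the equator the formal mating \<open>F\<close> is injective
(\<open>Infinity_not_critical\<close>), and \<open>F\<close> preserves the equator and its complement; hence the equator
does not meet the post-critical set. On the equator \<open>F\<close> is \<open>w \<mapsto> w ^ d\<close>, so for a point \<open>v\<close> of it
the set \<open>F\<^sup>-\<^sup>n v\<close> consists of the \<open>d ^ n\<close> roots \<open>w ^ (d ^ n) = v\<close>, and the lift of one turn around
the equator that starts at \<open>w\<close> ends at \<open>w * cis (2 * pi / d ^ n)\<close> (\<open>equator_lift\<close>). This
permutation is a single cycle on every level (\<open>cyclic_on_roots\<close>).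

The base point \<open>t\<close> is arbitrary, so it is first joined to the equator, in the complement of the
post-critical set, by a path \<open>\<alpha>\<close>: if \<open>t\<close> lies in one of the planes, only finitely many points have
to be avoided there, and a ray from \<open>t\<close> to infinity in a suitable direction will do
(\<open>path_to_equator\<close>). The loop that goes along
\<open>\<alpha>\<close>, once around the equator and back along \<open>\<alpha>\<close> acts on the tree of \<open>t\<close> as the equator acts on the
preimages of the end point of \<open>\<alpha>\<close>, because lifting \<open>\<alpha>\<close> identifies the two sets of preimages level by
level (\<open>IMG_contains_odometer\<close>).

That the monodromy action is well defined rests on \<open>F\<close> being a covering over the complement
of the post-critical set. This is proved by counting: the sphere is compact, \<open>F\<close> is locally
injective away from its critical points, and every point outside the post-critical set has
exactly \<open>d\<close> preimages; such a map is a covering (\<open>covering_space_constant_fibre_card\<close>). Paths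
and homotopies are then lifted through one application of \<open>F\<close> at a time.\<close>

section \<open>Coverings from fibres of constant cardinality\<close>

lemma disjoint_open_nbhds_finite:
  fixes X :: "'a::t2_space set"
  assumes "finite X"
  obtains W where "\<And>x. x \<in> X \<Longrightarrow> open (W x)" "\<And>x. x \<in> X \<Longrightarrow> x \<in> W x"
    "\<And>x x'. x \<in> X \<Longrightarrow> x' \<in> X \<Longrightarrow> x \<noteq> x' \<Longrightarrow> W x \<inter> W x' = {}"
proof -
  have "\<exists>A B. x \<noteq> x' \<longrightarrow> open A \<and> open B \<and> x \<in> A \<and> x' \<in> B \<and> A \<inter> B = {}" for x x' :: 'a
    by (meson hausdorff)
  then obtain A B where AB: "\<And>x x'::'a. x \<noteq> x' \<Longrightarrow>
      open (A x x') \<and> open (B x x') \<and> x \<in> A x x' \<and> x' \<in> B x x' \<and> A x x' \<inter> B x x' = {}"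
    by metis
  show ?thesis
  proof
    let ?W = "\<lambda>x. \<Inter>x'\<in>X - {x}. A x x' \<inter> B x' x"
    show "open (?W x)" if "x \<in> X" for x
      using assms AB by (intro open_INT) auto
    show "x \<in> ?W x" if "x \<in> X" for x
      using AB by (metis (no_types, lifting) DiffE INT_I IntI singletonI)
    show "?W x \<inter> ?W x' = {}" if "x \<in> X" "x' \<in> X" "x \<noteq> x'" for x x'
    proof -
      have "?W x \<subseteq> A x x'" "?W x' \<subseteq> B x x'"
        using that by auto
      then show ?thesis
        using AB[OF that(3)] by blast
    qed
  qed
qed

text \<open>Around a point \<open>y\<close> of \<open>V\<close>, the sheets are neighbourhoods of the \<open>d\<close> points over \<open>y\<close> on which \<open>p\<close> is
injective. The image \<open>C\<close> of the rest of \<open>K\<close> is compact and misses \<open>y\<close>, so over \<open>V - C\<close> all fibres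
lie in the sheets. No openness of \<open>p\<close> is needed.\<close>

lemma covering_space_constant_fibre_card:
  fixes p :: "'a::t2_space \<Rightarrow> 'b::t2_space"
  assumes K: "compact K" and cont: "continuous_on K p" and "d > 0"
    and card: "\<And>y. y \<in> V \<Longrightarrow> card {x \<in> K. p x = y} = d"
    and inj: "\<And>x. x \<in> K \<Longrightarrow> p x \<in> V \<Longrightarrow> \<exists>U. open U \<and> x \<in> U \<and> inj_on p (U \<inter> K)"
  shows "covering_space (K \<inter> p -` V) p V"
proof (rule covering_spaceI)
  show cont': "continuous_on (K \<inter> p -` V) p"
    using cont by (rule continuous_on_subset) auto
  show "p ` (K \<inter> p -` V) = V"
  proof -
    have "\<exists>x\<in>K. p x = y" if "y \<in> V" for y
      using card[OF that] \<open>d > 0\<close> by (metis (mono_tags, lifting) Collect_empty_eq card.empty less_irrefl)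
    then show ?thesis by fast
  qed
  fix y assume y: "y \<in> V"
  define X where "X = {x \<in> K. p x = y}"
  have cX: "card X = d" and fX: "finite X"
    using card[OF y] \<open>d > 0\<close> by (auto simp: X_def intro: card_ge_0_finite)
  have XK: "X \<subseteq> K" by (auto simp: X_def)
  obtain W where W: "\<And>x. x \<in> X \<Longrightarrow> open (W x)" "\<And>x. x \<in> X \<Longrightarrow> x \<in> W x"
    "\<And>x x'. x \<in> X \<Longrightarrow> x' \<in> X \<Longrightarrow> x \<noteq> x' \<Longrightarrow> W x \<inter> W x' = {}"
    using disjoint_open_nbhds_finite[OF fX] by metis
  have "\<forall>x\<in>X. \<exists>U. open U \<and> x \<in> U \<and> inj_on p (U \<inter> K)"
    using inj y by (auto simp: X_def)
  then obtain I where I: "\<And>x. x \<in> X \<Longrightarrow> open (I x) \<and> x \<in> I x \<and> inj_on p (I x \<inter> K)"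
    by metis
  define U where "U = (\<lambda>x. W x \<inter> I x)"
  have Uopen: "open (U x)" and Ux: "x \<in> U x" and Uinj: "inj_on p (U x \<inter> K)" if "x \<in> X" for x
    using W I that by (auto simp: U_def intro: inj_on_subset[of p "I x \<inter> K"])
  have Udisj: "x = x'" if "x \<in> X" "x' \<in> X" "z \<in> U x" "z \<in> U x'" for x x' z
    using W(3) that by (auto simp: U_def)
  define C where "C = p ` (K - (\<Union>x\<in>X. U x))"
  have closed_image: "closed (p ` (K \<inter> Z))" if "closed Z" for Z
    using K cont that by (meson compact_Int_closed compact_continuous_image compact_imp_closed
        continuous_on_subset inf_le1)
  have "open (\<Union>x\<in>X. U x)" using Uopen by auto
  then have C: "closed C"
    using closed_image[of "- (\<Union>x\<in>X. U x)"] by (simp add: C_def Diff_eq closed_def)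
  define T where "T = V - C"
  have TU: "\<exists>x\<in>X. z \<in> U x" if "z \<in> K" "p z \<in> T" for z
    using that by (auto simp: T_def C_def)
  have T1: "y \<in> T"
    using y Ux by (auto simp: T_def C_def X_def)
  have T2: "openin (top_of_set V) T"
    using C unfolding T_def by (simp add: openin_open_Int open_Compl Diff_eq)
  define v where "v = (\<lambda>x. U x \<inter> K \<inter> p -` T) ` X"
  have v1: "\<Union>v = (K \<inter> p -` V) \<inter> p -` T"
    using TU by (auto simp: v_def T_def)
  have v2: "openin (top_of_set (K \<inter> p -` V)) u" if "u \<in> v" for u
  proof -
    obtain x where x: "x \<in> X" "u = U x \<inter> K \<inter> p -` T" using \<open>u \<in> v\<close> by (auto simp: v_def)
    have "openin (top_of_set (K \<inter> p -` V)) ((K \<inter> p -` V) \<inter> p -` (- C))"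
      using C continuous_openin_preimage_gen[OF cont'] by (simp add: open_Compl)
    then have "openin (top_of_set (K \<inter> p -` V)) (((K \<inter> p -` V) \<inter> p -` (- C)) \<inter> U x)"
      using Uopen[OF x(1)] by (simp add: openin_Int_open)
    moreover have "u = ((K \<inter> p -` V) \<inter> p -` (- C)) \<inter> U x"
      using x by (auto simp: T_def)
    ultimately show ?thesis by simp
  qed
  have v3: "pairwise disjnt v"
  proof (rule pairwiseI)
    fix a b assume "a \<in> v" "b \<in> v" "a \<noteq> b"
    then obtain x x' where "x \<in> X" "x' \<in> X" "a = U x \<inter> K \<inter> p -` T" "b = U x' \<inter> K \<inter> p -` T"
      by (auto simp: v_def)
    then show "disjnt a b"
      using \<open>a \<noteq> b\<close> Udisj[of x x'] by (auto simp: disjnt_def)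
  qed
  have v4: "\<exists>q. homeomorphism u T p q" if "u \<in> v" for u
  proof -
    obtain x where x: "x \<in> X" "u = U x \<inter> K \<inter> p -` T" using \<open>u \<in> v\<close> by (auto simp: v_def)
    \<comment> \<open>A fibre over a point of \<open>T\<close> has at most one point in each of the \<open>d\<close> sets \<open>U x\<close>, hence
      exactly one.\<close>
    have surj: "\<exists>z\<in>u. p z = y'" if y': "y' \<in> T" for y'
    proof (rule ccontr)
      assume no: "\<not> (\<exists>z\<in>u. p z = y')"
      let ?Y = "{z \<in> K. p z = y'}"
      have "\<forall>z\<in>?Y. \<exists>x'\<in>X. z \<in> U x'" using TU y' by auto
      then obtain h where h: "\<And>z. z \<in> ?Y \<Longrightarrow> h z \<in> X \<and> z \<in> U (h z)" by metis
      have "h z \<noteq> x" if "z \<in> ?Y" for z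
        using h[OF that] that no x y' by auto
      then have "h ` ?Y \<subseteq> X - {x}" using h by auto
      moreover have "inj_on h ?Y"
      proof (rule inj_onI)
        fix z w assume "z \<in> ?Y" "w \<in> ?Y" "h z = h w"
        then show "z = w"
          using h[of z] h[of w] Uinj[of "h z"] by (auto dest: inj_onD)
      qed
      ultimately have "card ?Y \<le> card (X - {x})"
        using fX by (meson card_inj_on_le finite_Diff)
      also have "\<dots> < d"
        using x(1) fX cX by (metis card_Diff1_less)
      finally show False using card[of y'] y' by (simp add: T_def)
    qed
    have "closedin (top_of_set T) (p ` R)" if R: "closedin (top_of_set u) R" for R
    proof -
      obtain Z where Z: "closed Z" "R = u \<inter> Z"
        using R by (auto simp: closedin_closed)
      let ?O = "\<Union>x'\<in>X - {x}. U x'"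
      have "open ?O" using Uopen by auto
      then have "closed (p ` (K \<inter> (Z - ?O)))"
        using Z(1) by (intro closed_image closed_Diff)
      moreover have "p ` R = T \<inter> p ` (K \<inter> (Z - ?O))"
      proof
        show "p ` R \<subseteq> T \<inter> p ` (K \<inter> (Z - ?O))"
        proof
          fix w assume "w \<in> p ` R"
          then obtain z where z: "w = p z" "z \<in> U x" "z \<in> K" "p z \<in> T" "z \<in> Z"
            using x Z by auto
          then have "z \<notin> ?O" using Udisj[OF x(1) _ z(2)] by blast
          then show "w \<in> T \<inter> p ` (K \<inter> (Z - ?O))" using z by blast
        qed
        show "T \<inter> p ` (K \<inter> (Z - ?O)) \<subseteq> p ` R"
        proof
          fix w assume "w \<in> T \<inter> p ` (K \<inter> (Z - ?O))"
          then obtain z where z: "w = p z" "z \<in> K" "p z \<in> T" "z \<in> Z" "z \<notin> ?O" by blast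
          then have "z \<in> U x" using TU[of z] by blast
          then show "w \<in> p ` R" using z x Z by blast
        qed
      qed
      ultimately show ?thesis by (simp add: closedin_closed_Int)
    qed
    moreover have "p ` u = T"
    proof
      show "p ` u \<subseteq> T" unfolding x by auto
      show "T \<subseteq> p ` u" using surj by (metis image_eqI subsetI)
    qed
    moreover have "inj_on p u"
      using Uinj[OF x(1)] x by (auto intro: inj_on_subset)
    moreover have "continuous_on u p"
      using cont by (rule continuous_on_subset) (use x in auto)
    ultimately show ?thesis
      by (meson homeomorphism_injective_closed_map)
  qed
  show "\<exists>T. y \<in> T \<and> openin (top_of_set V) T \<and>
      (\<exists>v. \<Union>v = (K \<inter> p -` V) \<inter> p -` T \<and> (\<forall>u\<in>v. openin (top_of_set (K \<inter> p -` V)) u) \<and>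
        pairwise disjnt v \<and> (\<forall>u\<in>v. \<exists>q. homeomorphism u T p q))"
    by (intro exI[of _ T] exI[of _ v] conjI ballI T1 T2 v1 v2 v3 v4)
qed

section \<open>Lifting through iterates\<close>

lemma is_lift_compose:
  assumes "is_lift F (n + m) \<gamma> \<delta>" "continuous_on UNIV F"
  shows "is_lift F n \<gamma> ((F ^^ m) \<circ> \<delta>)"
proof -
  have "continuous_on UNIV (F ^^ m)"
  proof (induction m)
    case (Suc m)
    then show ?case
      using assms(2) by (metis continuous_on_compose continuous_on_subset funpow.simps(2) subset_UNIV)
  qed (simp add: id_def continuous_on_id)
  then have "path ((F ^^ m) \<circ> \<delta>)"
    using assms(1) by (metis is_lift_def continuous_on_subset path_continuous_image subset_UNIV)
  then show ?thesis
    using assms(1) by (auto simp: is_lift_def funpow_add)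
qed

lemma is_lift_join:
  assumes "is_lift F n \<gamma> \<delta>" "is_lift F n \<gamma>' \<delta>'" "pathfinish \<delta> = pathstart \<delta>'"
  shows "is_lift F n (\<gamma> +++ \<gamma>') (\<delta> +++ \<delta>')"
proof -
  have "path (\<delta> +++ \<delta>')"
    using assms by (simp add: is_lift_def)
  then show ?thesis
    using assms by (auto simp: is_lift_def joinpaths_def)
qed

lemma is_lift_reversepath:
  assumes "is_lift F n \<gamma> \<delta>"
  shows "is_lift F n (reversepath \<gamma>) (reversepath \<delta>)"
proof -
  have "path (reversepath \<delta>)"
    using assms by (simp add: is_lift_def)
  then show ?thesis
    using assms by (auto simp: is_lift_def reversepath_def)
qed

text \<open>What is needed of a covering \<open>F\<close> of \<open>A\<close>, whose domain \<open>F -` A\<close> is contained in \<open>A\<close>: paths in \<open>A\<close> lift,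
and lifts of homotopic paths from a common starting point are homotopic in \<open>A\<close>. Because lifts stay
in \<open>A\<close>, they can be lifted again.\<close>

locale homotopy_lifting =
  fixes F :: "'a::topological_space \<Rightarrow> 'a" and A :: "'a set"
  assumes cont: "continuous_on UNIV F"
    and backward: "F x \<in> A \<Longrightarrow> x \<in> A"
    and lift1: "\<lbrakk>path \<gamma>; path_image \<gamma> \<subseteq> A; F x = pathstart \<gamma>\<rbrakk> \<Longrightarrow>
      \<exists>\<delta>. is_lift F 1 \<gamma> \<delta> \<and> pathstart \<delta> = x"
    and homotopic1: "\<lbrakk>homotopic_paths A \<gamma> \<gamma>'; is_lift F 1 \<gamma> \<delta>; is_lift F 1 \<gamma>' \<delta>';
      pathstart \<delta> = pathstart \<delta>'\<rbrakk> \<Longrightarrow> homotopic_paths A \<delta> \<delta>'"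

begin

lemma lift_image1:
  assumes "is_lift F 1 \<gamma> \<delta>" "path_image \<gamma> \<subseteq> A"
  shows "path_image \<delta> \<subseteq> A"
  using assms backward by (auto simp: is_lift_def path_image_def image_subset_iff)

lemma lift_exists:
  assumes "path \<gamma>" "path_image \<gamma> \<subseteq> A" "(F ^^ n) x = pathstart \<gamma>"
  shows "\<exists>\<delta>. is_lift F n \<gamma> \<delta> \<and> pathstart \<delta> = x"
  using assms
proof (induction n arbitrary: \<gamma>)
  case 0
  then show ?case by (auto simp: is_lift_def)
next
  case (Suc n)
  obtain \<eta> where \<eta>: "is_lift F 1 \<gamma> \<eta>" "pathstart \<eta> = (F ^^ n) x"
    using lift1[of \<gamma> "(F ^^ n) x"] Suc.prems by auto
  then have "path \<eta>" "path_image \<eta> \<subseteq> A"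
    using lift_image1 Suc.prems by (auto simp: is_lift_def)
  then obtain \<delta> where "is_lift F n \<eta> \<delta>" "pathstart \<delta> = x"
    using Suc.IH \<eta> by metis
  then show ?case
    using \<eta> by (intro exI[of _ \<delta>]) (auto simp: is_lift_def)
qed

lemma lift_finish_unique:
  assumes "homotopic_paths A \<gamma> \<gamma>'" "is_lift F n \<gamma> \<delta>" "is_lift F n \<gamma>' \<delta>'" "pathstart \<delta> = pathstart \<delta>'"
  shows "pathfinish \<delta> = pathfinish \<delta>'"
  using assms
proof (induction n arbitrary: \<gamma> \<gamma>')
  case 0
  then have "pathfinish \<gamma> = pathfinish \<gamma>'"
    by (simp add: homotopic_paths_imp_pathfinish)
  then show ?case
    using 0 by (simp add: is_lift_def pathfinish_def)
next
  case (Suc n)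
  have l: "is_lift F 1 \<gamma> ((F ^^ n) \<circ> \<delta>)" "is_lift F 1 \<gamma>' ((F ^^ n) \<circ> \<delta>')"
    using Suc.prems cont by (auto intro: is_lift_compose)
  then have "homotopic_paths A ((F ^^ n) \<circ> \<delta>) ((F ^^ n) \<circ> \<delta>')"
    using homotopic1 Suc.prems by (simp add: pathstart_compose)
  then show ?case
  proof (rule Suc.IH)
    show "is_lift F n ((F ^^ n) \<circ> \<delta>) \<delta>" "is_lift F n ((F ^^ n) \<circ> \<delta>') \<delta>'"
      using Suc.prems by (auto simp: is_lift_def)
  qed (use Suc.prems in auto)
qed

text \<open>The defining description in \<^const>\<open>monodromy\<close> ranges over all loops of the class \<open>c\<close>; a single lift of
a single representative determines the value.\<close>

lemma monodromy_class:
  assumes \<gamma>: "\<gamma> \<in> loops A t" and c: "c = {\<gamma>' \<in> loops A t. homotopic_paths A \<gamma> \<gamma>'}"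
    and \<delta>: "is_lift F n \<gamma> \<delta>"
  shows "monodromy F t c (n, pathstart \<delta>) = (n, pathfinish \<delta>)"
proof -
  have "(F ^^ n) (pathstart \<delta>) = t"
    using \<gamma> \<delta> by (auto simp: is_lift_def loops_def pathstart_def)
  then have v: "(n, pathstart \<delta>) \<in> tree_vertices F t"
    by (auto simp: tree_vertices_def tree_level_def)
  have "(THE y. \<exists>\<gamma>'\<in>c. \<exists>\<delta>'. is_lift F n \<gamma>' \<delta>' \<and> pathstart \<delta>' = pathstart \<delta> \<and> pathfinish \<delta>' = y) =
      pathfinish \<delta>"
  proof (rule the_equality)
    show "\<exists>\<gamma>'\<in>c. \<exists>\<delta>'. is_lift F n \<gamma>' \<delta>' \<and> pathstart \<delta>' = pathstart \<delta> \<and> pathfinish \<delta>' = pathfinish \<delta>"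
      using \<gamma> \<delta> by (intro bexI[of _ \<gamma>]) (auto simp: c loops_def)
    show "y = pathfinish \<delta>"
      if "\<exists>\<gamma>'\<in>c. \<exists>\<delta>'. is_lift F n \<gamma>' \<delta>' \<and> pathstart \<delta>' = pathstart \<delta> \<and> pathfinish \<delta>' = y" for y
      using that lift_finish_unique \<delta> by (auto simp: c)
  qed
  then show ?thesis
    using v by (simp add: monodromy_def)
qed

end

text \<open>The space \<open>'a\<close> is transported along \<open>e\<close>, which is a homeomorphism onto its image since \<open>'a\<close> is
compact, into a normed space, where lifting of paths and homotopies through coverings is available.\<close>

lemma homotopy_lifting_if_constant_fibre_card:
  fixes F :: "'a::topological_space \<Rightarrow> 'a" and e :: "'a \<Rightarrow> 'b::real_normed_vector"
  assumes comp: "compact (UNIV :: 'a set)" and e: "continuous_on UNIV e" "inj e"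
    and F: "continuous_on UNIV F" and "d > 0"
    and card: "\<And>y. y \<in> A \<Longrightarrow> card {x. F x = y} = d"
    and inj: "\<And>x. F x \<in> A \<Longrightarrow> \<exists>U. open U \<and> x \<in> U \<and> inj_on F U"
    and backward: "\<And>x. F x \<in> A \<Longrightarrow> x \<in> A"
  shows "homotopy_lifting F A"
proof -
  define e' where "e' = inv_into UNIV e"
  define K where "K = range e"
  define p where "p = e \<circ> F \<circ> e'"
  define V where "V = e ` A"
  define C where "C = K \<inter> p -` V"
  have inv: "e' (e x) = x" for x
    using e(2) by (simp add: e'_def)
  have p: "p (e x) = e (F x)" for x
    by (simp add: p_def inv)
  have compK: "compact K"
    unfolding K_def using comp e(1) by (rule compact_continuous_image[rotated])
  have cont_inv: "continuous_on K e'"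
    unfolding K_def using e(1) comp by (rule continuous_on_inv) (simp add: inv)
  have C: "e x \<in> C \<longleftrightarrow> F x \<in> A" for x
    using e(2) by (auto simp: C_def K_def V_def p inj_image_mem_iff)
  have cov: "covering_space C p V"
    unfolding C_def
  proof (rule covering_space_constant_fibre_card[OF compK _ \<open>d > 0\<close>])
    have "continuous_on K (\<lambda>y. F (e' y))"
      using F cont_inv by (rule continuous_on_compose2) auto
    then have "continuous_on K (\<lambda>y. e (F (e' y)))"
      by (rule continuous_on_compose2[OF e(1)]) auto
    then show "continuous_on K p"
      by (simp add: p_def comp_def)
    show "card {x \<in> K. p x = y} = d" if "y \<in> V" for y
    proof -
      obtain a where a: "a \<in> A" "y = e a" using \<open>y \<in> V\<close> by (auto simp: V_def)
      have "{x \<in> K. p x = y} = e ` {x. F x = a}"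
        using e(2) by (auto simp: K_def a p inj_eq)
      then show ?thesis
        using card[OF a(1)] e(2) by (simp add: card_image inj_on_subset)
    qed
    show "\<exists>U. open U \<and> x \<in> U \<and> inj_on p (U \<inter> K)" if "x \<in> K" "p x \<in> V" for x
    proof -
      obtain a where a: "x = e a" using \<open>x \<in> K\<close> by (auto simp: K_def)
      then have "F a \<in> A" using \<open>p x \<in> V\<close> e(2) by (auto simp: V_def p inj_image_mem_iff)
      then obtain U where U: "open U" "a \<in> U" "inj_on F U" using inj by blast
      have "compact (- U)"
        using U(1) comp by (metis Compl_eq_Diff_UNIV compact_diff)
      then have "compact (e ` (- U))"
        using e(1) by (meson compact_continuous_image continuous_on_subset subset_UNIV)
      then have "open (- e ` (- U))"
        by (simp add: compact_imp_closed open_Compl)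
      moreover have "x \<in> - e ` (- U)"
        using a U(2) e(2) by (auto simp: inj_eq)
      moreover have "inj_on p (- e ` (- U) \<inter> K)"
      proof (rule inj_onI)
        fix y z assume yz: "y \<in> - e ` (- U) \<inter> K" "z \<in> - e ` (- U) \<inter> K" "p y = p z"
        then obtain b c where bc: "y = e b" "z = e c" by (auto simp: K_def)
        then have "b \<in> U" "c \<in> U" "F b = F c"
          using yz e(2) by (auto simp: p inj_eq)
        then show "y = z" using U(3) bc by (auto dest: inj_onD)
      qed
      ultimately show ?thesis by blast
    qed
  qed
  have path_e: "path (e \<circ> \<gamma>)" if "path \<gamma>" for \<gamma> :: "real \<Rightarrow> 'a"
    using that e(1) by (meson continuous_on_subset path_continuous_image subset_UNIV)
  have image_e: "path_image (e \<circ> \<gamma>) \<subseteq> V" if "path_image \<gamma> \<subseteq> A" for \<gamma> :: "real \<Rightarrow> 'a"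
    using that by (auto simp: path_image_def V_def)
  show ?thesis
  proof
    show "continuous_on UNIV F" by fact
    show "F x \<in> A \<Longrightarrow> x \<in> A" for x by fact
    fix \<gamma> \<gamma>' :: "real \<Rightarrow> 'a"
    show "\<exists>\<delta>. is_lift F 1 \<gamma> \<delta> \<and> pathstart \<delta> = x"
      if \<gamma>: "path \<gamma>" "path_image \<gamma> \<subseteq> A" "F x = pathstart \<gamma>" for x
    proof -
      have "F x \<in> A"
        using \<gamma> by (metis pathstart_in_path_image subsetD)
      then have "e x \<in> C" by (simp add: C)
      then obtain h where h: "path h" "path_image h \<subseteq> C" "pathstart h = e x"
        "\<And>s. s \<in> {0..1} \<Longrightarrow> p (h s) = (e \<circ> \<gamma>) s"
        using covering_space_lift_path_strong[OF cov, of "e x" "e \<circ> \<gamma>"]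
          path_e[OF \<gamma>(1)] image_e[OF \<gamma>(2)] \<gamma>(3)
        by (metis p pathstart_compose)
      have "path (e' \<circ> h)"
        using h cont_inv by (metis C_def continuous_on_subset inf_le1 path_continuous_image)
      moreover have "F ((e' \<circ> h) s) = \<gamma> s" if s: "s \<in> {0..1}" for s
      proof -
        have "h s \<in> K"
          using h(2) s by (auto simp: path_image_def C_def)
        then obtain b where b: "h s = e b" by (auto simp: K_def)
        then have "e (F b) = e (\<gamma> s)" using h(4)[OF s] by (simp add: p)
        then show ?thesis using e(2) b by (simp add: inj_eq inv)
      qed
      ultimately show ?thesis
        using h(3) by (intro exI[of _ "e' \<circ> h"]) (auto simp: is_lift_def pathstart_compose inv)
    qed
    show "homotopic_paths A \<delta> \<delta>'"
      if hom: "homotopic_paths A \<gamma> \<gamma>'" and \<delta>: "is_lift F 1 \<gamma> \<delta>" and \<delta>': "is_lift F 1 \<gamma>' \<delta>'"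
        and start: "pathstart \<delta> = pathstart \<delta>'" for \<delta> \<delta>'
    proof -
      have \<gamma>: "path \<gamma>" "path_image \<gamma> \<subseteq> A" "path \<gamma>'" "path_image \<gamma>' \<subseteq> A"
        using hom by (auto dest: homotopic_paths_imp_path homotopic_paths_imp_subset)
      have lifts: "path (e \<circ> \<eta>')" "path_image (e \<circ> \<eta>') \<subseteq> C"
          "\<And>s. s \<in> {0..1} \<Longrightarrow> p ((e \<circ> \<eta>') s) = (e \<circ> \<eta>) s"
        if "is_lift F 1 \<eta> \<eta>'" "path_image \<eta> \<subseteq> A" for \<eta> \<eta>'
        using that by (auto simp: is_lift_def path_e path_image_def C p)
      have "homotopic_paths V (e \<circ> \<gamma>) (e \<circ> \<gamma>')"
        using hom
      proof (rule homotopic_paths_continuous_image)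
        show "continuous_on A e" using e(1) by (rule continuous_on_subset) simp
      qed (simp add: V_def)
      then have "homotopic_paths C (e \<circ> \<delta>) (e \<circ> \<delta>')"
        using \<gamma> start
        by (intro covering_space_lift_homotopic_paths[OF cov, of "e \<circ> \<gamma>" "e \<circ> \<gamma>'"] path_e image_e lifts[OF \<delta>] lifts[OF \<delta>'])
          (auto simp: pathstart_compose)
      moreover have "continuous_on C (e')"
        using cont_inv by (rule continuous_on_subset) (auto simp: C_def)
      moreover have "e' \<in> C \<rightarrow> A"
      proof
        fix y assume y: "y \<in> C"
        then obtain x where "y = e x" by (auto simp: C_def K_def)
        then show "e' y \<in> A" using y backward C by (simp add: inv)
      qed
      ultimately have "homotopic_paths A (e' \<circ> (e \<circ> \<delta>)) (e' \<circ> (e \<circ> \<delta>'))"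
        by (rule homotopic_paths_continuous_image)
      then show ?thesis by (simp add: comp_def inv)
    qed
  qed
qed

section \<open>Monodromy along a conjugated loop\<close>

text \<open>The last hypothesis says that \<open>g\<close> commutes with passing to the parent vertex. Bijectivity comes for
free: \<open>g\<close> maps each level, a finite set, onto itself.\<close>

lemma tree_automorphism_if_cyclic:
  fixes F :: "'a \<Rightarrow> 'a"
  assumes ext: "g \<in> extensional (tree_vertices F t)"
    and cyc: "\<And>n. cyclic_on g (tree_level F t n)"
    and comm: "\<And>n x y. (F ^^ Suc n) x = t \<Longrightarrow> g (Suc n, x) = (Suc n, y) \<Longrightarrow> g (n, F x) = (n, F y)"
  shows "g \<in> tree_automorphisms F t"
proof -
  have lev: "g ` tree_level F t n = tree_level F t n" for n
  proof -
    have "g ` orbit g s = orbit g s" if "orbit g s = tree_level F t n" "s \<in> tree_level F t n" for s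
      using orbit_inverse[of s g g g] that by (metis cyc cyclic_on_alldef cyclic_on_inI)
    then show ?thesis
      using cyc[of n] unfolding cyclic_on_def by metis
  qed
  have fin: "finite (tree_level F t n)" for n
    using cyc finite_cyclic_on by blast
  have injl: "inj_on g (tree_level F t n)" for n
    using lev fin by (simp add: eq_card_imp_inj_on)
  have level_iff: "(n, x) \<in> tree_level F t m \<longleftrightarrow> m = n \<and> (F ^^ n) x = t" for n m x
    by (auto simp: tree_level_def)
  have vert: "(n, x) \<in> tree_vertices F t \<longleftrightarrow> (F ^^ n) x = t" for n x
    by (auto simp: tree_vertices_def level_iff)
  have image: "\<exists>y. g (n, x) = (n, y) \<and> (F ^^ n) y = t" if "(F ^^ n) x = t" for n x
  proof -
    have "g (n, x) \<in> tree_level F t n"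
      using that lev[of n] level_iff[of n x n] by blast
    then show ?thesis by (auto simp: tree_level_def)
  qed
  have inj: "inj_on g (tree_vertices F t)"
  proof (rule inj_onI)
    fix v w assume vw: "v \<in> tree_vertices F t" "w \<in> tree_vertices F t" "g v = g w"
    obtain n x m y where e: "v = (n, x)" "w = (m, y)" by fastforce
    have "n = m" using image[of n x] image[of m y] vw e vert by auto
    then show "v = w"
      using injl[of n] vw e vert level_iff by (auto dest: inj_onD)
  qed
  have onto: "g ` tree_vertices F t = tree_vertices F t"
    unfolding tree_vertices_def by (simp add: image_UN lev)
  have edge: "{v, w} \<in> tree_edges F t \<longleftrightarrow>
      (\<exists>n x. (F ^^ Suc n) x = t \<and> (v = (n, F x) \<and> w = (Suc n, x) \<or> w = (n, F x) \<and> v = (Suc n, x)))"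
    for v w :: "nat \<times> 'a"
    by (auto simp: tree_edges_def doubleton_eq_iff)
  have edge_iff: "v = (n, F x) \<longleftrightarrow> g v = (n, F y)"
    if "v \<in> tree_vertices F t" "(F ^^ Suc n) x = t" "g (Suc n, x) = (Suc n, y)" for v n x y
  proof
    show "g v = (n, F y)" if "v = (n, F x)"
      using that comm \<open>(F ^^ Suc n) x = t\<close> \<open>g (Suc n, x) = (Suc n, y)\<close> by simp
    show "v = (n, F x)" if "g v = (n, F y)"
    proof -
      have "(n, F x) \<in> tree_vertices F t"
        using \<open>(F ^^ Suc n) x = t\<close> by (simp add: vert funpow_swap1)
      moreover have "g (n, F x) = (n, F y)" 
        using comm \<open>(F ^^ Suc n) x = t\<close> \<open>g (Suc n, x) = (Suc n, y)\<close> by simp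
      ultimately show ?thesis
        using inj that \<open>v \<in> tree_vertices F t\<close> by (metis inj_onD)
    qed
  qed
  have half: "(\<exists>n x. (F ^^ Suc n) x = t \<and> v = (n, F x) \<and> w = (Suc n, x)) \<longleftrightarrow>
      (\<exists>n x. (F ^^ Suc n) x = t \<and> g v = (n, F x) \<and> g w = (Suc n, x))" (is "?L \<longleftrightarrow> ?R")
    if vw: "v \<in> tree_vertices F t" "w \<in> tree_vertices F t" for v w
  proof
    assume ?L
    then obtain n x where nx: "(F ^^ Suc n) x = t" "v = (n, F x)" "w = (Suc n, x)" by blast
    then obtain y where "g w = (Suc n, y)" "(F ^^ Suc n) y = t" using image by metis
    then show ?R using edge_iff[of v n x y] nx vw by auto
  next
    assume ?R
    then obtain n y where ny: "(F ^^ Suc n) y = t" "g v = (n, F y)" "g w = (Suc n, y)" by blast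
    obtain m x where w: "w = (m, x)" by fastforce
    then have m: "m = Suc n" "(F ^^ Suc n) x = t"
      using image[of m x] vw vert ny by auto
    then show ?L using edge_iff[of v n x y] ny vw w by auto
  qed
  have "{v, w} \<in> tree_edges F t \<longleftrightarrow> {g v, g w} \<in> tree_edges F t"
    if "v \<in> tree_vertices F t" "w \<in> tree_vertices F t" for v w
    using half[OF that] half[OF that(2,1)] unfolding edge by blast
  moreover have "g (0, t) = (0, t)"
    using image[of 0 t] by auto
  ultimately show ?thesis
    using ext inj onto by (simp add: tree_automorphisms_def Bij_def bij_betw_def)
qed

context homotopy_lifting
begin

text \<open>If the lifts of a loop \<open>\<epsilon>\<close> at \<open>b\<close> permute the \<open>n\<close>-th preimages of \<open>b\<close> by a cyclic permutation \<open>\<rho> n\<close>, then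
the loop \<open>\<alpha> +++ \<epsilon> +++ reversepath \<alpha>\<close> acts cyclically on each level of the tree of \<open>t\<close>. The bijection
\<open>\<tau> n\<close> from the preimages of \<open>b\<close> to those of \<open>t\<close> sends the end point of a lift of \<open>\<alpha>\<close> to its starting point.\<close>

lemma IMG_contains_odometer:
  assumes \<alpha>: "path \<alpha>" "path_image \<alpha> \<subseteq> A" "pathstart \<alpha> = t" "pathfinish \<alpha> = b"
    and \<epsilon>: "path \<epsilon>" "path_image \<epsilon> \<subseteq> A" "pathstart \<epsilon> = b" "pathfinish \<epsilon> = b"
    and lift: "\<And>n y. (F ^^ n) y = b \<Longrightarrow> \<exists>\<delta>. is_lift F n \<epsilon> \<delta> \<and> pathstart \<delta> = y \<and> pathfinish \<delta> = \<rho> n y"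
    and cyc: "\<And>n. cyclic_on (\<rho> n) {y. (F ^^ n) y = b}"
    and A: "A = - post_critical_set F"
  shows "\<exists>g \<in> carrier (IMG F t). g \<in> tree_automorphisms F t \<and>
    (\<forall>n. cyclic_on g (tree_level F t n) \<and> card (tree_level F t n) = card {y. (F ^^ n) y = b})"
proof -
  define \<gamma> where "\<gamma> = \<alpha> +++ (\<epsilon> +++ reversepath \<alpha>)"
  have \<gamma>: "\<gamma> \<in> loops A t"
    using \<alpha> \<epsilon> by (auto simp: loops_def \<gamma>_def path_image_join)
  define c where "c = {\<gamma>' \<in> loops A t. homotopic_paths A \<gamma> \<gamma>'}"
  have "c \<in> pi1 A t"
    unfolding pi1_def
    by (rule quotientI[of \<gamma>, THEN back_subst[of "\<lambda>c. c \<in> _"]]) (use \<gamma> in \<open>auto simp: c_def\<close>)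
  define g where "g = monodromy F t c"
  have g: "g (n, pathstart \<delta>) = (n, pathfinish \<delta>)" if "is_lift F n \<gamma> \<delta>" for n \<delta>
    unfolding g_def using monodromy_class[OF \<gamma> c_def that] .
  have "g \<in> carrier (IMG F t)"
    using \<open>c \<in> pi1 A t\<close> by (simp add: IMG_def g_def A)
  have unique: "pathfinish \<delta> = pathfinish \<delta>'"
    if "is_lift F n \<eta> \<delta>" "is_lift F n \<eta> \<delta>'" "pathstart \<delta> = pathstart \<delta>'" "path \<eta>" "path_image \<eta> \<subseteq> A"
    for n \<eta> \<delta> \<delta>'
  proof (rule lift_finish_unique)
    show "homotopic_paths A \<eta> \<eta>" using that by simp
  qed (fact that)+
  \<comment> \<open>\<open>L n y\<close> is the lift of \<open>\<alpha>\<close> ending at \<open>y\<close>, obtained by lifting the reversed path from \<open>y\<close>.\<close>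
  have "\<exists>\<delta>. (F ^^ n) y = b \<longrightarrow> is_lift F n \<alpha> \<delta> \<and> pathfinish \<delta> = y" for n y
  proof (cases "(F ^^ n) y = b")
    case True
    then obtain \<delta> where "is_lift F n (reversepath \<alpha>) \<delta>" "pathstart \<delta> = y"
      using lift_exists[of "reversepath \<alpha>" n y] \<alpha> by auto
    then show ?thesis
      using is_lift_reversepath[of F n "reversepath \<alpha>" \<delta>] by (intro exI[of _ "reversepath \<delta>"]) auto
  qed auto
  then obtain L where L: "\<And>n y. (F ^^ n) y = b \<Longrightarrow> is_lift F n \<alpha> (L n y) \<and> pathfinish (L n y) = y"
    by metis
  define \<tau> where "\<tau> = (\<lambda>n y. pathstart (L n y))"
  have \<tau>_inj: "inj_on (\<tau> n) {y. (F ^^ n) y = b}" for n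
  proof (rule inj_onI)
    fix y y' assume "y \<in> {y. (F ^^ n) y = b}" "y' \<in> {y. (F ^^ n) y = b}" "\<tau> n y = \<tau> n y'"
    then show "y = y'"
      using L unique[of n \<alpha> "L n y" "L n y'"] \<alpha> by (auto simp: \<tau>_def)
  qed
  have \<tau>_image: "\<tau> n ` {y. (F ^^ n) y = b} = {x. (F ^^ n) x = t}" for n
  proof (intro equalityI subsetI)
    fix x assume "x \<in> \<tau> n ` {y. (F ^^ n) y = b}"
    then show "x \<in> {x. (F ^^ n) x = t}"
      using L \<alpha> by (fastforce simp: \<tau>_def is_lift_def pathstart_def)
  next
    fix x assume "x \<in> {x. (F ^^ n) x = t}"
    then obtain \<delta> where \<delta>: "is_lift F n \<alpha> \<delta>" "pathstart \<delta> = x"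
      using lift_exists[of \<alpha> n x] \<alpha> by auto
    define y where "y = pathfinish \<delta>"
    have y: "(F ^^ n) y = b"
      using \<delta> \<alpha> by (auto simp: y_def is_lift_def pathfinish_def)
    have "pathfinish (reversepath (L n y)) = pathfinish (reversepath \<delta>)"
    proof (rule unique)
      show "is_lift F n (reversepath \<alpha>) (reversepath (L n y))" "is_lift F n (reversepath \<alpha>) (reversepath \<delta>)"
        using L[OF y] \<delta> by (auto intro: is_lift_reversepath)
    qed (use \<alpha> L[OF y] y_def in auto)
    then have "\<tau> n y = x" using \<delta> by (simp add: \<tau>_def)
    then show "x \<in> \<tau> n ` {y. (F ^^ n) y = b}" using y by blast
  qed
  have level: "tree_level F t n = (\<lambda>y. (n, \<tau> n y)) ` {y. (F ^^ n) y = b}" for n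
    using \<tau>_image[of n] by (auto simp: tree_level_def)
  have g_\<tau>: "g (n, \<tau> n y) = (n, \<tau> n (\<rho> n y))" if y: "(F ^^ n) y = b" for n y
  proof -
    obtain \<delta> where \<delta>: "is_lift F n \<epsilon> \<delta>" "pathstart \<delta> = y" "pathfinish \<delta> = \<rho> n y"
      using lift y by blast
    have "(F ^^ n) (\<rho> n y) = b"
      using \<delta> \<epsilon> by (metis atLeastAtMost_iff is_lift_def order_refl pathfinish_def zero_le_one)
    then have "is_lift F n \<gamma> (L n y +++ (\<delta> +++ reversepath (L n (\<rho> n y))))"
      unfolding \<gamma>_def using L[OF y] L[of n "\<rho> n y"] \<delta>
      by (intro is_lift_join is_lift_reversepath) auto
    from g[OF this] show ?thesis by (simp add: \<tau>_def)
  qed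
  have cyc_g: "cyclic_on g (tree_level F t n)" for n
    unfolding level by (rule cyclic_on_image[OF cyc]) (use g_\<tau> in auto)
  have "g \<in> tree_automorphisms F t"
  proof (rule tree_automorphism_if_cyclic[OF _ cyc_g])
    show "g \<in> extensional (tree_vertices F t)"
      by (simp add: g_def monodromy_def)
    fix n x y assume x: "(F ^^ Suc n) x = t" and gx: "g (Suc n, x) = (Suc n, y)"
    obtain \<delta> where \<delta>: "is_lift F (Suc n) \<gamma> \<delta>" "pathstart \<delta> = x"
      using lift_exists[of \<gamma> "Suc n" x] \<gamma> x by (auto simp: loops_def)
    then have "y = pathfinish \<delta>" using g[of "Suc n" \<delta>] gx by simp
    moreover have "is_lift F n \<gamma> (F \<circ> \<delta>)"
      using is_lift_compose[of F n 1 \<gamma> \<delta>] \<delta> cont by simp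
    ultimately show "g (n, F x) = (n, F y)"
      using g[of n "F \<circ> \<delta>"] \<delta> by (simp add: pathstart_compose pathfinish_compose)
  qed
  moreover have "card (tree_level F t n) = card {y. (F ^^ n) y = b}" for n
    unfolding level using \<tau>_inj[of n] by (intro card_image) (auto simp: inj_on_def)
  ultimately show ?thesis
    using \<open>g \<in> carrier (IMG F t)\<close> cyc_g by blast
qed

end

section \<open>The compactified plane\<close>

lemma continuous_to_disc: "continuous_on UNIV to_disc"
  unfolding continuous_on_open_vimage[OF open_UNIV] open_compact_plane_def by auto

lemma continuous_on_compact_plane_iff:
  fixes f :: "'a::topological_space \<Rightarrow> compact_plane"
  shows "continuous_on A f \<longleftrightarrow> continuous_on A (\<lambda>x. to_disc (f x))"
proof
  show "continuous_on A (\<lambda>x. to_disc (f x))" if "continuous_on A f"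
    using continuous_to_disc that by (rule continuous_on_compose2) auto
  show "continuous_on A f" if *: "continuous_on A (\<lambda>x. to_disc (f x))"
    unfolding continuous_on_open_invariant
  proof (intro allI impI)
    fix B :: "compact_plane set" assume "open B"
    then obtain V where V: "open V" "B = to_disc -` V"
      unfolding open_compact_plane_def by blast
    then obtain U where "open U" "U \<inter> A = (\<lambda>x. to_disc (f x)) -` V \<inter> A"
      using * unfolding continuous_on_open_invariant by metis
    then show "\<exists>U. open U \<and> U \<inter> A = f -` B \<inter> A"
      using V by (intro exI[of _ U]) auto
  qed
qed

lemma inj_to_disc: "inj to_disc"
  using bij_betw_to_disc by (simp add: bij_betw_def)

lemma norm_to_disc_le: "norm (to_disc x) \<le> 1"
  using bij_betw_to_disc by (auto simp: bij_betw_def)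

lemma norm_circle_val [simp]: "norm (circle_val u) = 1"
  using circle_val[of u] by simp

lemma norm_to_disc_eq_1_iff: "norm (to_disc x) = 1 \<longleftrightarrow> (\<exists>u. x = Infinity u)"
proof (cases x)
  case (Finite z)
  have "norm z / (1 + norm z) < 1"
    by (simp add: divide_less_eq add_pos_nonneg)
  then show ?thesis using Finite by (simp add: norm_to_disc_Finite del: to_disc.simps)
qed auto

lemma compact_UNIV_compact_plane: "compact (UNIV :: compact_plane set)"
proof -
  define g where "g = inv_into UNIV to_disc"
  have g: "to_disc (g w) = w" if "w \<in> cball 0 1" for w
    using that bij_betw_to_disc by (metis bij_betw_def f_inv_into_f g_def)
  have "continuous_on (cball 0 1) g"
    unfolding continuous_on_compact_plane_iff
    using continuous_on_id by (rule continuous_on_eq) (simp add: g)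
  then have "compact (g ` cball 0 1)"
    by (intro compact_continuous_image) auto
  moreover have "g ` cball 0 1 = UNIV"
    using inj_to_disc norm_to_disc_le by (auto simp: g_def image_iff intro!: bexI[of _ "to_disc _"])
  ultimately show ?thesis by simp
qed

lemma to_disc_Finite_scale:
  fixes z :: complex
  defines "r \<equiv> 1 / (1 + norm z)"
  shows "r > 0" "to_disc (Finite z) = of_real r * z" "1 - norm (to_disc (Finite z)) = r"
proof -
  have pos: "1 + norm z > 0" by (simp add: add_pos_nonneg)
  then show "r > 0" by (simp add: r_def)
  show "to_disc (Finite z) = of_real r * z"
    by (simp add: r_def)
  show "1 - norm (to_disc (Finite z)) = r"
    unfolding norm_to_disc_Finite r_def using pos by (simp add: field_simps)
qed

lemma open_Finite_image:
  assumes "open U"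
  shows "open (Finite ` U)"
proof -
  let ?h = "\<lambda>w::complex. w / of_real (1 - norm w)"
  have "open (ball 0 1 \<inter> ?h -` U)"
    using assms by (intro continuous_open_preimage) (auto intro!: continuous_intros)
  moreover have "Finite ` U = to_disc -` (ball 0 1 \<inter> ?h -` U)"
  proof (rule Set.set_eqI)
    fix x
    show "x \<in> Finite ` U \<longleftrightarrow> x \<in> to_disc -` (ball 0 1 \<inter> ?h -` U)"
    proof (cases x)
      case (Finite z)
      define r where "r = 1 / (1 + norm z)"
      have r: "r > 0" "to_disc (Finite z) = of_real r * z" "1 - norm (to_disc (Finite z)) = r"
        unfolding r_def by (fact to_disc_Finite_scale)+
      have "norm (to_disc x) < 1"
        using norm_to_disc_eq_1_iff[of x] norm_to_disc_le[of x] Finite by simp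
      moreover have "?h (to_disc x) = z"
        unfolding Finite r(3) unfolding r(2) using r(1) by simp
      ultimately show ?thesis using Finite by auto
    qed auto
  qed
  ultimately show ?thesis
    unfolding open_compact_plane_def by blast
qed

section \<open>Polynomials near infinity\<close>

text \<open>A polynomial of degree at most \<open>d\<close>, homogenized to degree \<open>d\<close> with \<open>1 - norm w\<close> as the second variable.
In the coordinate \<open>w\<close> of the closed unit disc this is a rescaled version of \<open>f\<close> that extends
continuously to the boundary circle.\<close>

definition homogenize :: "nat \<Rightarrow> complex poly \<Rightarrow> complex \<Rightarrow> complex" where
  "homogenize d f w = (\<Sum>k\<le>d. coeff f k * w ^ k * of_real (1 - norm w) ^ (d - k))"

lemma continuous_on_homogenize: "continuous_on A (homogenize d f)"
  unfolding homogenize_def by (intro continuous_intros)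

lemma homogenize_to_disc_Finite:
  assumes "degree f \<le> d"
  shows "homogenize d f (to_disc (Finite z)) = of_real ((1 / (1 + norm z)) ^ d) * poly f z"
proof -
  define r where "r = 1 / (1 + norm z)"
  have r: "to_disc (Finite z) = of_real r * z" "1 - norm (to_disc (Finite z)) = r"
    unfolding r_def by (fact to_disc_Finite_scale)+
  have "homogenize d f (to_disc (Finite z)) =
      (\<Sum>k\<le>d. coeff f k * (of_real r * z) ^ k * of_real r ^ (d - k))"
    unfolding homogenize_def r(2) unfolding r(1) ..
  also have "\<dots> = (\<Sum>k\<le>d. of_real (r ^ d) * (coeff f k * z ^ k))"
  proof (rule sum.cong)
    fix k assume "k \<in> {..d}"
    then have "complex_of_real r ^ d = of_real r ^ k * of_real r ^ (d - k)"
      by (simp flip: power_add)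
    then show "coeff f k * (of_real r * z) ^ k * of_real r ^ (d - k) = of_real (r ^ d) * (coeff f k * z ^ k)"
      by (simp add: power_mult_distrib)
  qed simp
  also have "\<dots> = of_real (r ^ d) * poly f z"
  proof -
    have "poly f z = (\<Sum>k\<le>d. coeff f k * z ^ k)"
      unfolding poly_altdef using assms by (intro sum.mono_neutral_left) (auto simp: coeff_eq_0)
    then show ?thesis by (simp add: sum_distrib_left)
  qed
  finally show ?thesis by (simp add: r_def)
qed

lemma homogenize_norm_1:
  assumes "norm w = 1"
  shows "homogenize d f w = coeff f d * w ^ d"
proof -
  have "homogenize d f w = (\<Sum>k\<le>d. if k = d then coeff f d * w ^ d else 0)"
    unfolding homogenize_def using assms by (intro sum.cong) auto
  then show ?thesis by simp
qed

lemma continuous_extend_poly: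
  assumes "degree f = d" "lead_coeff f = 1" "d > 0"
  shows "continuous_on UNIV (extend_poly d f)"
proof -
  \<comment> \<open>In the disc coordinate the extended map is a single quotient of continuous functions; the
    denominator does not vanish, since at the boundary the numerator has norm 1.\<close>
  define D where "D = (\<lambda>w. (1 - norm w) ^ d + norm (homogenize d f w))"
  have D0: "D w \<noteq> 0" if "norm w \<le> 1" for w
  proof (cases "norm w = 1")
    case True
    then show ?thesis
      using assms by (simp add: D_def homogenize_norm_1 norm_mult norm_power zero_power)
  next
    case False
    then have "(1 - norm w) ^ d > 0" using that by simp
    then show ?thesis unfolding D_def by (smt (verit) norm_ge_zero)
  qed
  have cont: "continuous_on (cball 0 1) (\<lambda>w. homogenize d f w / of_real (D w))"
  proof (rule continuous_on_divide[OF continuous_on_homogenize])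
    show "continuous_on (cball 0 1) (\<lambda>w. complex_of_real (D w))"
      unfolding D_def by (intro continuous_intros continuous_on_homogenize)
    show "\<forall>w\<in>cball 0 1. complex_of_real (D w) \<noteq> 0"
      using D0 by simp
  qed
  have eq: "to_disc (extend_poly d f x) = homogenize d f (to_disc x) / of_real (D (to_disc x))" for x
  proof (cases x)
    case (Infinity u)
    then show ?thesis using assms
      by (simp add: D_def homogenize_norm_1 circle_power.rep_eq norm_mult norm_power zero_power)
  next
    case (Finite z)
    define r where "r = (1 / (1 + norm z)) ^ d"
    have "1 + norm z > 0" by (simp add: add_pos_nonneg)
    then have r: "r > 0" by (simp add: r_def)
    have h: "homogenize d f (to_disc x) = of_real r * poly f z"
      unfolding Finite r_def using assms by (intro homogenize_to_disc_Finite) simp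
    have "D (to_disc x) = r + norm (of_real r * poly f z)"
      unfolding D_def h unfolding Finite to_disc_Finite_scale(3) r_def ..
    also have "\<dots> = r * (1 + norm (poly f z))"
      using r by (simp add: norm_mult algebra_simps)
    finally have "homogenize d f (to_disc x) / of_real (D (to_disc x)) =
        poly f z / of_real (1 + norm (poly f z))"
      using r unfolding h by simp
    then show ?thesis using Finite by simp
  qed
  have "continuous_on UNIV (\<lambda>x. homogenize d f (to_disc x) / of_real (D (to_disc x)))"
    using cont continuous_to_disc by (rule continuous_on_compose2) (auto simp: norm_to_disc_le)
  then show ?thesis
    unfolding continuous_on_compact_plane_iff eq .
qed

text \<open>The Noshiro-Warschawski criterion: a holomorphic function whose derivative takes values in an open
half plane bounded by a line through the origin is injective on convex sets.\<close>

lemma inj_on_poly_convex: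
  assumes "convex S" and pos: "\<And>z. z \<in> S \<Longrightarrow> Re (c * poly (pderiv f) z) > 0"
  shows "inj_on (poly f) S"
proof (rule inj_onI, rule ccontr)
  fix z w assume zw: "z \<in> S" "w \<in> S" "poly f z = poly f w" "z \<noteq> w"
  \<comment> \<open>Along the segment from \<open>w\<close> to \<open>z\<close> the real part of \<open>c * poly f / (z - w)\<close> is strictly
    increasing.\<close>
  let ?l = "\<lambda>s::real. w + of_real s * (z - w)"
  let ?\<phi> = "\<lambda>s. Re (c * poly f (?l s) / (z - w))"
  have "?\<phi> 0 < ?\<phi> 1"
  proof (rule DERIV_pos_imp_increasing[of 0 1 ?\<phi>])
    fix s :: real assume s: "0 \<le> s" "s \<le> 1"
    have "((\<lambda>s. c * poly f (w + s * (z - w)) / (z - w)) has_field_derivative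
        c * (poly (pderiv f) (?l s) * (z - w)) / (z - w)) (at (of_real s))"
      by (rule DERIV_cong, (rule derivative_eq_intros poly_DERIV[THEN DERIV_chain2] refl | simp add: zw)+)
    then have "((\<lambda>s. c * poly f (?l s) / (z - w)) has_vector_derivative
        c * (poly (pderiv f) (?l s) * (z - w)) / (z - w)) (at s)"
      by (rule has_vector_derivative_real_field)
    then have "(?\<phi> has_field_derivative Re (c * (poly (pderiv f) (?l s) * (z - w)) / (z - w))) (at s)"
      by (rule has_field_derivative_Re)
    moreover have "?l s = (1 - s) *\<^sub>R w + s *\<^sub>R z"
      by (simp add: scaleR_conv_of_real algebra_simps)
    then have "?l s \<in> S"
      using convexD_alt[OF \<open>convex S\<close> zw(2,1) s] by simp
    ultimately show "\<exists>y. (?\<phi> has_field_derivative y) (at s) \<and> y > 0"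
      using pos zw(4) by auto
  qed simp
  then show False using zw(3) by simp
qed

text \<open>The caps \<open>{a. norm a \<le> 1 \<and> Re (a * cnj u) > 1 - \<epsilon>}\<close> form a neighbourhood base of the boundary
point \<open>u\<close> in the closed disc.\<close>

lemma positive_on_cap:
  fixes \<phi> :: "complex \<Rightarrow> real"
  assumes "continuous_on UNIV \<phi>" "\<phi> u > 0" "norm u = 1"
  obtains \<epsilon> where "\<epsilon> > 0" "\<epsilon> \<le> 1" "\<And>a. norm a \<le> 1 \<Longrightarrow> Re (a * cnj u) > 1 - \<epsilon> \<Longrightarrow> \<phi> a > 0"
proof -
  have "open (\<phi> -` {0<..})"
    using assms(1) by (intro open_vimage) auto
  then obtain \<delta> where \<delta>: "\<delta> > 0" "ball u \<delta> \<subseteq> \<phi> -` {0<..}"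
    using assms(2) by (auto elim: openE)
  show ?thesis
  proof (rule that[of "min 1 (\<delta>\<^sup>2 / 2)"])
    fix a :: complex assume a: "norm a \<le> 1" "Re (a * cnj u) > 1 - min 1 (\<delta>\<^sup>2 / 2)"
    have "(norm (a - u))\<^sup>2 = (norm a)\<^sup>2 + (norm u)\<^sup>2 - 2 * Re (a * cnj u)"
      unfolding cmod_power2 by (simp add: power2_eq_square algebra_simps)
    also have "(norm a)\<^sup>2 \<le> 1" using a(1) by (simp add: power_le_one)
    finally have "(norm (a - u))\<^sup>2 < \<delta>\<^sup>2"
      using a(2) assms(3) by simp
    then have "norm (a - u) < \<delta>"
      using \<delta>(1) by (simp add: power_less_imp_less_base)
    then show "\<phi> a > 0"
      using subsetD[OF \<delta>(2), of a] by (simp add: dist_norm norm_minus_commute)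
  qed (use \<delta> in auto)
qed

lemma convex_Re_cap: "convex {a. Re (a * cnj u) > r}"
proof -
  have "{a. Re (a * cnj u) > r} = {a. inner u a > r}"
    by (auto simp: inner_complex_def algebra_simps)
  then show ?thesis by (simp add: convex_halfspace_gt)
qed

lemma inj_power_near:
  assumes "d > 0" "norm u = 1"
  obtains \<epsilon> where "\<epsilon> > 0" "inj_on (\<lambda>a. a ^ d) {a. norm a \<le> 1 \<and> Re (a * cnj u) > 1 - \<epsilon>}"
proof -
  let ?p = "monom (1::complex) d"
  let ?c = "cnj (u ^ (d - 1))"
  have cont: "continuous_on UNIV (\<lambda>a. Re (?c * poly (pderiv ?p) a))"
    by (intro continuous_intros)
  have "?c * u ^ (d - 1) = 1"
    using assms(2) by (metis complex_norm_square mult.commute norm_one norm_power of_real_1 power_one)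
  then have "?c * (of_nat d * u ^ (d - 1)) = of_nat d"
    by (simp add: mult.left_commute)
  moreover have "poly (pderiv ?p) u = of_nat d * u ^ (d - 1)"
    by (simp add: pderiv_monom poly_monom)
  ultimately have "Re (?c * poly (pderiv ?p) u) = Re (of_nat d)"
    by (simp only:)
  then have "Re (?c * poly (pderiv ?p) u) > 0"
    using assms(1) by (simp only: complex_Re_of_nat of_nat_0_less_iff)
  then obtain \<epsilon> where \<epsilon>: "\<epsilon> > 0"
      "\<And>a. norm a \<le> 1 \<Longrightarrow> Re (a * cnj u) > 1 - \<epsilon> \<Longrightarrow> Re (?c * poly (pderiv ?p) a) > 0"
    using positive_on_cap[OF cont _ assms(2)] by metis
  have "{a. norm a \<le> 1 \<and> Re (a * cnj u) > 1 - \<epsilon>} = cball 0 1 \<inter> {a. Re (a * cnj u) > 1 - \<epsilon>}"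
    by auto
  then have "convex {a. norm a \<le> 1 \<and> Re (a * cnj u) > 1 - \<epsilon>}"
    by (simp only: convex_Int convex_Re_cap convex_cball)
  then have "inj_on (poly ?p) {a. norm a \<le> 1 \<and> Re (a * cnj u) > 1 - \<epsilon>}"
    using \<epsilon>(2) by (rule inj_on_poly_convex) auto
  then show ?thesis using \<epsilon>(1) that by (simp add: poly_monom[abs_def])
qed

text \<open>In the coordinate \<open>z\<close> of the plane the cap is \<open>{z. (1 - \<epsilon>) * (1 + norm z) < Re (z * cnj u)}\<close>,
which for \<open>\<epsilon> \<le> 1\<close> is convex since the norm is. There \<open>pderiv f\<close> is, up to a positive factor, its homogenization,
whose value at \<open>u\<close> is \<open>d * u ^ (d - 1)\<close>; so \<open>inj_on_poly_convex\<close> applies near \<open>u\<close>.\<close>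

lemma inj_poly_near_infinity:
  assumes f: "degree f = d" "lead_coeff f = 1" and "d > 0" "norm u = 1"
  obtains \<epsilon> where "\<epsilon> > 0" "inj_on (poly f) {z. Re (to_disc (Finite z) * cnj u) > 1 - \<epsilon>}"
proof -
  let ?c = "cnj (u ^ (d - 1))"
  let ?h = "homogenize (d - 1) (pderiv f)"
  have cont: "continuous_on UNIV (\<lambda>a. Re (?c * ?h a))"
    by (intro continuous_intros continuous_on_homogenize)
  have "?c * u ^ (d - 1) = 1"
    using assms(4) by (metis complex_norm_square mult.commute norm_one norm_power of_real_1 power_one)
  then have "?c * (of_nat d * u ^ (d - 1)) = of_nat d"
    by (simp add: mult.left_commute)
  moreover have "?h u = of_nat d * u ^ (d - 1)"
    using assms by (simp add: homogenize_norm_1 coeff_pderiv)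
  ultimately have "Re (?c * ?h u) = Re (of_nat d)"
    by (simp only:)
  then have "Re (?c * ?h u) > 0"
    using assms(3) by (simp only: complex_Re_of_nat of_nat_0_less_iff)
  then obtain \<epsilon> where \<epsilon>: "\<epsilon> > 0" "\<epsilon> \<le> 1"
      "\<And>a. norm a \<le> 1 \<Longrightarrow> Re (a * cnj u) > 1 - \<epsilon> \<Longrightarrow> Re (?c * ?h a) > 0"
    using positive_on_cap[OF cont _ assms(4)] by metis
  have Re_scale: "Re (of_real r * w) = r * Re w" for r w
    by simp
  let ?S = "{z. Re (to_disc (Finite z) * cnj u) > 1 - \<epsilon>}"
  have S: "z \<in> ?S \<longleftrightarrow> (1 - \<epsilon>) * (1 + norm z) < Re (z * cnj u)" for z
  proof -
    have "to_disc (Finite z) * cnj u = of_real (1 / (1 + norm z)) * (z * cnj u)"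
      by simp
    then have "Re (to_disc (Finite z) * cnj u) = 1 / (1 + norm z) * Re (z * cnj u)"
      by (simp only: Re_scale)
    then have "Re (to_disc (Finite z) * cnj u) = Re (z * cnj u) / (1 + norm z)"
      by (simp only: times_divide_eq_left mult_1_left)
    moreover have "1 + norm z > 0" by (simp add: add_pos_nonneg)
    ultimately show ?thesis by (simp add: pos_less_divide_eq)
  qed
  have "convex ?S"
  proof (rule convexI)
    fix x y :: complex and a b :: real
    assume xy: "x \<in> ?S" "y \<in> ?S" and ab: "0 \<le> a" "0 \<le> b" "a + b = 1"
    have "norm (a *\<^sub>R x + b *\<^sub>R y) \<le> a * norm x + b * norm y"
      using ab norm_triangle_ineq[of "a *\<^sub>R x" "b *\<^sub>R y"] by simp
    then have "(1 - \<epsilon>) * (1 + norm (a *\<^sub>R x + b *\<^sub>R y)) \<le> (1 - \<epsilon>) * (1 + (a * norm x + b * norm y))"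
      using \<epsilon>(2) by (intro mult_left_mono) auto
    also have "\<dots> = (1 - \<epsilon>) * (a * (1 + norm x) + b * (1 + norm y))"
    proof -
      have "1 + (a * norm x + b * norm y) = a * (1 + norm x) + b * (1 + norm y)"
        using ab(3) by (simp add: algebra_simps)
      then show ?thesis by (simp only:)
    qed
    also have "\<dots> = a * ((1 - \<epsilon>) * (1 + norm x)) + b * ((1 - \<epsilon>) * (1 + norm y))"
      by (simp add: algebra_simps)
    also have "\<dots> < a * Re (x * cnj u) + b * Re (y * cnj u)"
    proof (cases "a = 0")
      case True
      then show ?thesis using ab xy S by simp
    next
      case False
      then show ?thesis
        using ab xy unfolding S by (intro add_less_le_mono mult_strict_left_mono mult_left_mono) auto
    qed
    also have "\<dots> = Re ((a *\<^sub>R x + b *\<^sub>R y) * cnj u)"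
      by (simp add: algebra_simps)
    finally show "a *\<^sub>R x + b *\<^sub>R y \<in> ?S" unfolding S .
  qed
  moreover have "Re (?c * poly (pderiv f) z) > 0" if "z \<in> ?S" for z
  proof -
    define r where "r = (1 / (1 + norm z)) ^ (d - 1)"
    have "1 + norm z > 0" by (simp add: add_pos_nonneg)
    then have r: "r > 0" by (simp add: r_def)
    have "Re (?c * ?h (to_disc (Finite z))) > 0"
      using \<epsilon>(3)[OF norm_to_disc_le] that by blast
    moreover have "?h (to_disc (Finite z)) = of_real r * poly (pderiv f) z"
      unfolding r_def using f by (intro homogenize_to_disc_Finite) (simp add: degree_pderiv)
    moreover have "?c * (of_real r * poly (pderiv f) z) = of_real r * (?c * poly (pderiv f) z)"
      by (simp add: mult.left_commute)
    ultimately have "0 < r * Re (?c * poly (pderiv f) z)"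
      by (simp only: Re_scale)
    then show ?thesis using r by (simp add: zero_less_mult_iff)
  qed
  ultimately show ?thesis
    using inj_on_poly_convex that \<epsilon>(1) by blast
qed

lemma card_roots_if_simple:
  fixes p :: "complex poly"
  assumes "p \<noteq> 0" "\<And>z. poly p z = 0 \<Longrightarrow> poly (pderiv p) z \<noteq> 0"
  shows "card {z. poly p z = 0} = degree p"
proof -
  let ?Z = "{z. poly p z = 0}"
  have "rsquarefree p"
    using assms by (auto simp: rsquarefree_roots)
  then have "degree p = degree (smult (lead_coeff p) (\<Prod>z | poly p z = 0. [:- z, 1:]))"
    by (simp add: complex_poly_decompose_rsquarefree)
  also have "\<dots> = (\<Sum>z\<in>?Z. degree [:- z, 1:])"
    using assms(1) by (simp add: degree_prod_eq_sum_degree)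
  finally show ?thesis by simp
qed

lemma deriv_poly: "deriv (poly p) z = poly (pderiv p) z" for p :: "complex poly"
  using poly_DERIV by (rule DERIV_imp_deriv)

lemma holomorphic_poly: "poly p holomorphic_on A" for p :: "complex poly"
  unfolding holomorphic_on_def field_differentiable_def
  using poly_DERIV has_field_derivative_at_within by blast

section \<open>The sphere\<close>

text \<open>The inclusion of the first (\<open>True\<close>) or second (\<open>False\<close>) closed hemisphere.\<close>

definition hemi :: "bool \<Rightarrow> compact_plane \<Rightarrow> mating_sphere" where
  "hemi b x = abs_mating_sphere (if b then Inl x else Inr x)"

text \<open>The equator is glued by complex conjugation, so the disc coordinate of the second hemisphere has
to be conjugated to agree with that of the first.\<close>

definition orient :: "bool \<Rightarrow> complex \<Rightarrow> complex" where
  "orient b w = (if b then w else cnj w)"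

lemma orient_simps [simp]:
  "norm (orient b w) = norm w" "cnj (orient b w) = orient b (cnj w)" "orient b (orient b w) = w"
  by (auto simp: orient_def)

lemma Re_orient_mult: "Re (orient b w * cnj u) = Re (w * cnj (orient b u))"
  by (auto simp: orient_def)

text \<open>An embedding onto a double cone: the reoriented disc coordinate, together with the distance of the
disc coordinate from the boundary circle, taken with opposite signs on the two hemispheres.\<close>

lift_definition embed_sphere :: "mating_sphere \<Rightarrow> complex \<times> real" is
  "\<lambda>p. case p of Inl x \<Rightarrow> (to_disc x, 1 - norm (to_disc x))
     | Inr x \<Rightarrow> (cnj (to_disc x), norm (to_disc x) - 1)"
  by (auto simp: glue_def circle_cnj.rep_eq)

lemma embed_sphere_hemi:
  "embed_sphere (hemi b x) = (orient b (to_disc x),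
     if b then 1 - norm (to_disc x) else norm (to_disc x) - 1)"
  by (simp add: hemi_def orient_def embed_sphere.abs_eq)

lemma hemi_exhaust:
  obtains b x where "p = hemi b x"
proof -
  obtain y where "p = abs_mating_sphere y"
    by (metis Quotient_abs_rep Quotient_mating_sphere)
  then show ?thesis
    using that[of True] that[of False] by (cases y) (auto simp: hemi_def)
qed

lemma hemi_eq_iff:
  "hemi b x = hemi b' y \<longleftrightarrow> b = b' \<and> x = y \<or>
     b \<noteq> b' \<and> (\<exists>u. x = Infinity u \<and> y = Infinity (circle_cnj u))"
proof -
  have "hemi b x = hemi b' y \<longleftrightarrow> glue (if b then Inl x else Inr x) (if b' then Inl y else Inr y)"
    unfolding hemi_def by (rule mating_sphere.abs_eq_iff)
  then show ?thesis
    by (auto simp: glue_def)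
qed

lemma hemi_Infinity: "hemi b (Infinity u) = hemi b' (Infinity (if b = b' then u else circle_cnj u))"
  by (simp add: hemi_eq_iff)

lemma mating_sphere_cases:
  obtains b z where "p = hemi b (Finite z)" | u where "p = hemi c (Infinity u)"
  using that by (metis compact_plane.exhaust hemi_Infinity hemi_exhaust)

lemma continuous_hemi: "continuous_on UNIV (hemi b)"
  by (cases b) (auto simp: continuous_on_open_vimage open_mating_sphere_def hemi_def vimage_def)

lemma continuous_from_mating_sphere:
  fixes h :: "mating_sphere \<Rightarrow> 'a::topological_space"
  assumes "\<And>b. continuous_on UNIV (\<lambda>x. h (hemi b x))"
  shows "continuous_on UNIV h"
  unfolding continuous_on_open_vimage[OF open_UNIV]
proof (intro allI impI)
  fix B :: "'a set" assume "open B"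
  then have "open ((\<lambda>x. h (hemi b x)) -` B)" for b
    using assms[of b] by (simp add: continuous_on_open_vimage)
  from this[of True] this[of False] show "open (h -` B \<inter> UNIV)"
    by (simp add: open_mating_sphere_def hemi_def vimage_def)
qed

lemma compact_UNIV_mating_sphere: "compact (UNIV :: mating_sphere set)"
proof -
  have "UNIV = range (hemi True) \<union> range (hemi False)"
    by (metis (full_types) UNIV_eq_I UnCI hemi_exhaust rangeI)
  then show ?thesis
    using compact_continuous_image[OF continuous_hemi compact_UNIV_compact_plane]
    by (metis compact_Un)
qed

lemma continuous_orient: "continuous_on A f \<Longrightarrow> continuous_on A (\<lambda>x. orient b (f x))"
  by (cases b) (auto simp: orient_def intro: continuous_intros)

lemma continuous_embed_sphere: "continuous_on UNIV embed_sphere"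
proof (rule continuous_from_mating_sphere)
  show "continuous_on UNIV (\<lambda>x. embed_sphere (hemi b x))" for b
    unfolding embed_sphere_hemi
    by (cases b) (auto intro!: continuous_intros continuous_orient continuous_to_disc)
qed

lemma inj_embed_sphere: "inj embed_sphere"
proof (rule injI)
  fix p q assume eq: "embed_sphere p = embed_sphere q"
  have key: "p = q" if "p = hemi b (Finite z)" "q = hemi c y" "embed_sphere p = embed_sphere q" for p q b z c y
  proof -
    have lt: "norm (to_disc (Finite z)) < 1"
      using norm_to_disc_le[of "Finite z"] norm_to_disc_eq_1_iff[of "Finite z"] by fastforce
    have "b = c" "to_disc (Finite z) = to_disc y"
      using that(3) lt norm_to_disc_le[of y] unfolding that(1,2) embed_sphere_hemi
      by (auto simp: orient_def simp del: to_disc.simps split: if_splits)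
    moreover from this(2) have "Finite z = y"
      by (rule injD[OF inj_to_disc])
    ultimately show ?thesis
      using that by simp
  qed
  show "p = q"
  proof (rule mating_sphere_cases[where p = p and c = True])
    show "p = q" if "p = hemi b (Finite z)" for b z
      using key[OF that] eq by (metis hemi_exhaust)
    fix u assume u: "p = hemi True (Infinity u)"
    show "p = q"
    proof (rule mating_sphere_cases[where p = q and c = True])
      show "p = q" if "q = hemi b (Finite z)" for b z
        using key[OF that] eq by (metis hemi_exhaust)
      show "p = q" if "q = hemi True (Infinity v)" for v
        using eq unfolding u that embed_sphere_hemi by (simp add: orient_def circle_val_inject)
    qed
  qed
qed

lemma continuous_hemi_Finite: "continuous_on UNIV (\<lambda>z. hemi b (Finite z))"
proof -
  have "1 + complex_of_real (norm z) \<noteq> 0" for z :: complex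
    by (metis norm_ge_zero add_nonneg_eq_0_iff of_real_1 of_real_add of_real_eq_0_iff zero_le_one zero_neq_one)
  then have "continuous_on UNIV Finite"
    unfolding continuous_on_compact_plane_iff by (auto intro!: continuous_intros)
  then show ?thesis
    by (rule continuous_on_compose2[OF continuous_hemi]) auto
qed

lemma open_hemi_Finite_image:
  assumes "open U"
  shows "open (hemi b ` Finite ` U)"
proof -
  have "(\<lambda>x. hemi c x) -` (hemi b ` Finite ` U) = (if b = c then Finite ` U else {})" for c
    by (auto simp: hemi_eq_iff)
  from this[of True] this[of False] show ?thesis
    using open_Finite_image[OF assms]
    by (simp add: open_mating_sphere_def) (simp add: hemi_def)
qed

text \<open>The equator, parametrized by the direction \<open>w\<close> at infinity of the hemisphere \<open>b\<close>; meaningful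
only for \<open>norm w = 1\<close>.\<close>

definition equator :: "bool \<Rightarrow> complex \<Rightarrow> mating_sphere" where
  "equator b w = hemi b (Infinity (Abs_circle w))"

lemma circle_val_Abs: "norm w = 1 \<Longrightarrow> circle_val (Abs_circle w) = w"
  by (simp add: Abs_circle_inverse)

lemma inj_on_equator: "inj_on (equator b) (sphere 0 1)"
proof (rule inj_onI)
  fix w w' assume w: "w \<in> sphere 0 1" "w' \<in> sphere 0 1" "equator b w = equator b w'"
  then have "circle_val (Abs_circle w) = circle_val (Abs_circle w')"
    by (simp add: equator_def hemi_eq_iff)
  then show "w = w'" using w by (simp add: circle_val_Abs)
qed

lemma continuous_equator:
  assumes "continuous_on A g" "\<And>s. s \<in> A \<Longrightarrow> norm (g s) = 1"
  shows "continuous_on A (\<lambda>s. equator b (g s))"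
proof -
  have "continuous_on A (\<lambda>s. Infinity (Abs_circle (g s)))"
    unfolding continuous_on_compact_plane_iff
    using assms(1) by (rule continuous_on_eq) (simp add: assms(2) circle_val_Abs)
  then show ?thesis
    unfolding equator_def by (rule continuous_on_compose2[OF continuous_hemi]) auto
qed

text \<open>The ray from \<open>z\<close> in the direction \<open>v\<close>, reparametrized by \<open>{0..1}\<close> so as to end at infinity.\<close>

definition ray :: "bool \<Rightarrow> complex \<Rightarrow> complex \<Rightarrow> real \<Rightarrow> mating_sphere" where
  "ray b z v s = hemi b (if s < 1 then Finite (z + of_real (s / (1 - s)) * v) else Infinity (Abs_circle v))"

lemma path_ray:
  assumes v: "norm v = 1"
  shows "path (ray b z v)"
proof -
  let ?x = "\<lambda>s. if s < 1 then Finite (z + of_real (s / (1 - s)) * v) else Infinity (Abs_circle v)"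
  let ?q = "\<lambda>s::real. of_real (1 - s) * z + of_real s * v"
  have ne: "(1 - s) + norm (?q s) \<noteq> 0" if "s \<in> {0..1}" for s
    using that v by (cases "s = 1") (auto simp: add_nonneg_eq_0_iff)
  have "continuous_on {0..1} (\<lambda>s. ?q s / of_real ((1 - s) + norm (?q s)))"
    by (intro continuous_intros) (use ne of_real_eq_0_iff in blast)
  moreover have "?q s / of_real ((1 - s) + norm (?q s)) = to_disc (?x s)" if s: "s \<in> {0..1}" for s
  proof (cases "s = 1")
    case True
    then show ?thesis using v by (simp add: circle_val_Abs)
  next
    case False
    then have pos: "1 - s > 0" using s by simp
    let ?w = "z + of_real (s / (1 - s)) * v"
    have q: "?q s = of_real (1 - s) * ?w"
      using pos by (simp add: field_simps del: of_real_diff)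
    have "norm (complex_of_real (1 - s)) = 1 - s"
      using pos by (metis abs_of_pos norm_of_real)
    then have "norm (?q s) = (1 - s) * norm ?w"
      unfolding q norm_mult by (simp only:)
    then have "(1 - s) + norm (?q s) = (1 - s) * (1 + norm ?w)"
      by (simp add: algebra_simps)
    then have "?q s / of_real ((1 - s) + norm (?q s)) = ?w / of_real (1 + norm ?w)"
      unfolding q using pos by (simp only: of_real_mult) simp
    then show ?thesis using pos by simp
  qed
  ultimately have "continuous_on {0..1} (\<lambda>s. to_disc (?x s))"
    by (rule continuous_on_eq)
  then have "continuous_on {0..1} ?x"
    unfolding continuous_on_compact_plane_iff .
  then have "continuous_on {0..1} (\<lambda>s. hemi b (?x s))"
    by (rule continuous_on_compose2[OF continuous_hemi]) auto
  then show ?thesis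
    unfolding path_def ray_def[abs_def] .
qed

section \<open>Roots on the unit circle\<close>

lemma circle_power_power: "circle_power (circle_power u m) n = circle_power u (m * n)"
  by transfer (simp add: power_mult)

lemma circle_power_1: "circle_power u 1 = u"
  by transfer simp

lemma norm_root_1:
  fixes w :: complex
  assumes "w ^ N = v" "norm v = 1" "N > 0"
  shows "norm w = 1"
proof -
  have "norm w ^ N = 1 ^ N" using assms by (simp flip: norm_power)
  then show ?thesis using assms(3) by (intro power_eq_imp_eq_base[of "norm w" N 1]) auto
qed

lemma infinite_circle: "infinite (sphere (0::complex) 1)"
proof
  assume "finite (sphere (0::complex) 1)"
  then have "finite (Re ` sphere 0 1)" by simp
  moreover have "{0..1} \<subseteq> Re ` sphere 0 1"
  proof
    fix x :: real assume "x \<in> {0..1}"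
    then have "Complex x (sqrt (1 - x\<^sup>2)) \<in> sphere 0 1"
      by (simp add: cmod_def power_le_one)
    then show "x \<in> Re ` sphere 0 1"
      by (metis complex.sel(1) imageI)
  qed
  ultimately show False
    by (metis finite_subset infinite_Icc zero_less_one)
qed

lemma cyclic_on_roots:
  fixes v :: complex
  assumes "N > 0" "v \<noteq> 0"
  shows "cyclic_on (\<lambda>w. w * cis (2 * pi / N)) {w. w ^ N = v}"
proof -
  let ?\<rho> = "\<lambda>w. w * cis (2 * pi / N)"
  have pow: "(?\<rho> ^^ k) w = w * cis (2 * pi * k / N)" for k w
    by (induction k) (simp_all add: cis_mult add_divide_distrib algebra_simps)
  have root: "cis (2 * pi * k / N) ^ N = 1" for k :: nat
    unfolding Complex.DeMoivre using assms(1) by (simp add: cis_multiple_2pi)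
  obtain w where w: "w ^ N = v"
    using card_nth_roots[OF assms(2,1)] assms(1) by (metis (mono_tags, lifting) Collect_empty_eq card.empty less_irrefl)
  have "w \<noteq> 0" using w assms by (auto simp: power_0_left)
  have "{w. w ^ N = v} = orbit ?\<rho> w"
  proof (intro equalityI subsetI)
    fix x assume "x \<in> {w. w ^ N = v}"
    then have "(x / w) ^ N = 1" using w assms(2) by (simp add: power_divide)
    then obtain k where "k < N" "x / w = cis (2 * pi * k / N)"
      using Complex.bij_betw_roots_unity[OF assms(1)] by (auto simp: bij_betw_def image_iff)
    then have "x = w * cis (2 * pi * k / N)"
      using \<open>w \<noteq> 0\<close> by (simp add: field_simps)
    \<comment> \<open>An orbit contains only iterates of positive order, and \<open>k\<close> may be \<open>0\<close>.\<close>
    then have "x = w * (cis (2 * pi * k / N) * cis (2 * pi))"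
      by simp
    also have "\<dots> = w * cis (2 * pi * (k + N) / N)"
    proof -
      have "2 * pi * (k + N) / N = 2 * pi * k / N + 2 * pi"
        using assms(1) by (simp add: add_divide_distrib distrib_left)
      then show ?thesis by (simp only: cis_mult)
    qed
    also have "\<dots> = (?\<rho> ^^ (k + N)) w" unfolding pow ..
    finally show "x \<in> orbit ?\<rho> w"
      using assms(1) unfolding orbit_altdef by blast
  next
    fix x assume "x \<in> orbit ?\<rho> w"
    then obtain k where "x = (?\<rho> ^^ k) w" unfolding orbit_altdef by blast
    then show "x \<in> {w. w ^ N = v}"
      unfolding pow by (simp add: power_mult_distrib root w)
  qed
  then show ?thesis using w by (intro cyclic_on_singleI[of w]) auto
qed

section \<open>The formal mating\<close>

lemma formal_mating_hemi:
  "formal_mating d f1 f2 (hemi b x) = hemi b (extend_poly d (if b then f1 else f2) x)"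
  by (cases b) (simp_all add: hemi_def formal_mating.abs_eq)

text \<open>The two polynomials as a family indexed by the hemispheres. The degree is only assumed to be positive.\<close>

locale monic_mating =
  fixes d :: nat and f :: "bool \<Rightarrow> complex poly"
  assumes d_pos: "d > 0" and deg: "degree (f b) = d" and monic: "lead_coeff (f b) = 1"

begin

text \<open>The formal mating of the two members of the family.\<close>

definition F :: "mating_sphere \<Rightarrow> mating_sphere" where
  "F = formal_mating d (f True) (f False)"

lemma F_hemi: "F (hemi b x) = hemi b (extend_poly d (f b) x)"
  by (cases b) (simp_all add: F_def formal_mating_hemi)

lemma F_Finite [simp]: "F (hemi b (Finite z)) = hemi b (Finite (poly (f b) z))"
  and F_Infinity [simp]: "F (hemi b (Infinity u)) = hemi b (Infinity (circle_power u d))"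
  by (simp_all add: F_hemi)

lemma F_eq_Finite:
  assumes "F p = hemi b (Finite w)"
  obtains z where "p = hemi b (Finite z)" "poly (f b) z = w"
proof (cases rule: mating_sphere_cases[where p = p and c = b])
  case (1 b' z)
  then show ?thesis using that[of z] assms by (auto simp: hemi_eq_iff)
next
  case (2 u)
  then show ?thesis using assms by (auto simp: hemi_eq_iff)
qed

lemma F_eq_Infinity:
  assumes "F p = hemi b (Infinity v)"
  obtains u where "p = hemi b (Infinity u)" "circle_power u d = v"
proof (cases rule: mating_sphere_cases[where p = p and c = b])
  case (1 b' z)
  then show ?thesis using assms by (auto simp: hemi_eq_iff)
next
  case (2 u)
  then show ?thesis using that[of u] assms by (auto simp: hemi_eq_iff)
qed

lemma continuous_F: "continuous_on UNIV F"
proof (rule continuous_from_mating_sphere)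
  show "continuous_on UNIV (\<lambda>x. F (hemi b x))" for b
    unfolding F_hemi
    by (rule continuous_on_compose2[OF continuous_hemi continuous_extend_poly[OF deg monic d_pos]]) auto
qed

lemma F_funpow_Finite: "(F ^^ n) (hemi b (Finite z)) = hemi b (Finite ((poly (f b) ^^ n) z))"
  by (induction n) simp_all

lemma F_funpow_Infinity: "(F ^^ n) (hemi b (Infinity u)) = hemi b (Infinity (circle_power u (d ^ n)))"
  by (induction n) (use circle_power_1 in \<open>simp_all add: circle_power_power mult.commute\<close>)

lemma F_funpow_equator:
  assumes "norm w = 1"
  shows "(F ^^ n) (equator b w) = equator b (w ^ (d ^ n))"
proof -
  have "circle_val (circle_power (Abs_circle w) (d ^ n)) = w ^ (d ^ n)"
    using assms by (simp add: circle_power.rep_eq circle_val_Abs)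
  then have "circle_power (Abs_circle w) (d ^ n) = Abs_circle (w ^ (d ^ n))"
    by (metis circle_val_inverse)
  then show ?thesis by (simp add: equator_def F_funpow_Infinity)
qed

lemma equator_fibre:
  assumes v: "norm v = 1"
  shows "{p. (F ^^ n) p = equator b v} = equator b ` {w. w ^ (d ^ n) = v}"
proof (intro equalityI subsetI)
  fix p assume "p \<in> {p. (F ^^ n) p = equator b v}"
  then have p: "(F ^^ n) p = equator b v" by simp
  show "p \<in> equator b ` {w. w ^ (d ^ n) = v}"
  proof (cases rule: mating_sphere_cases[where p = p and c = b])
    case (1 c z)
    then show ?thesis using p by (simp add: F_funpow_Finite equator_def hemi_eq_iff)
  next
    case (2 u)
    then have "p = equator b (circle_val u)" by (simp add: equator_def circle_val_inverse)
    moreover have "circle_val u ^ (d ^ n) = v"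
    proof (rule inj_onD[OF inj_on_equator])
      show "equator b (circle_val u ^ (d ^ n)) = equator b v"
        using p calculation F_funpow_equator[of "circle_val u" n b] by simp
    qed (use v in \<open>simp_all add: norm_power\<close>)
    ultimately show ?thesis by simp
  qed
next
  fix p assume "p \<in> equator b ` {w. w ^ (d ^ n) = v}"
  then obtain w where w: "p = equator b w" "w ^ (d ^ n) = v" by blast
  then have "norm w = 1" using norm_root_1[of w "d ^ n" v] v d_pos by simp
  then show "p \<in> {p. (F ^^ n) p = equator b v}" using w by (simp add: F_funpow_equator)
qed

lemma card_equator_fibre:
  assumes v: "norm v = 1"
  shows "card {p. (F ^^ n) p = equator b v} = d ^ n"
proof -
  have "{w. w ^ (d ^ n) = v} \<subseteq> sphere 0 1"
    using norm_root_1[of _ "d ^ n" v] v d_pos by auto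
  then have "inj_on (equator b) {w. w ^ (d ^ n) = v}"
    using inj_on_equator inj_on_subset by blast
  then have "card {p. (F ^^ n) p = equator b v} = card {w. w ^ (d ^ n) = v}"
    unfolding equator_fibre[OF v] by (rule card_image)
  also have "\<dots> = d ^ n"
    using v d_pos by (intro card_nth_roots) auto
  finally show ?thesis .
qed

text \<open>The neighbourhood \<open>N\<close> of the given point of the equator meets each hemisphere in a cap. Since \<open>F\<close> maps
each open hemisphere and the equator to itself, injectivity on \<open>N\<close> reduces to injectivity of the two
polynomials and of \<open>w \<mapsto> w ^ d\<close> on caps.\<close>

lemma Infinity_not_critical: "hemi b (Infinity u) \<notin> critical_points F"
proof -
  define v where "v = circle_val (if b then u else circle_cnj u)"
  have v: "norm v = 1" by (simp add: v_def)
  have u: "hemi b (Infinity u) = hemi True (Infinity (if b then u else circle_cnj u))"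
    using hemi_Infinity[of b u True] by simp
  have "\<exists>\<epsilon>>0. inj_on (poly (f c)) {z. Re (to_disc (Finite z) * cnj (orient c v)) > 1 - \<epsilon>}" for c
  proof -
    have "norm (orient c v) = 1" using v by simp
    from inj_poly_near_infinity[OF deg[of c] monic[of c] d_pos this] show ?thesis by blast
  qed
  then obtain \<epsilon> where \<epsilon>: "\<And>c. \<epsilon> c > 0"
      "\<And>c. inj_on (poly (f c)) {z. Re (to_disc (Finite z) * cnj (orient c v)) > 1 - \<epsilon> c}"
    by metis
  obtain \<epsilon>' where \<epsilon>': "\<epsilon>' > 0" "inj_on (\<lambda>a. a ^ d) {a. norm a \<le> 1 \<and> Re (a * cnj v) > 1 - \<epsilon>'}"
    by (rule inj_power_near[OF d_pos v])
  define r where "r = min \<epsilon>' (min (\<epsilon> True) (\<epsilon> False))"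
  have "r > 0"
    using \<epsilon>(1) \<epsilon>'(1) by (simp add: r_def)
  moreover have "r \<le> \<epsilon>'"
    by (simp add: r_def)
  moreover have "r \<le> \<epsilon> c" for c
    by (cases c) (simp_all add: r_def)
  ultimately have r: "r > 0" "r \<le> \<epsilon>'" "r \<le> \<epsilon> c" for c
    by simp_all
  define N where "N = {p. Re (fst (embed_sphere p) * cnj v) > 1 - r}"
  have N: "hemi c x \<in> N \<longleftrightarrow> Re (to_disc x * cnj (orient c v)) > 1 - r" for c x
    by (simp only: N_def embed_sphere_hemi mem_Collect_eq fst_conv Re_orient_mult)
  have "N = (\<lambda>p. Re (fst (embed_sphere p) * cnj v)) -` {1 - r<..}"
    by (auto simp: N_def)
  moreover have "open \<dots>"
    by (intro open_vimage continuous_intros continuous_embed_sphere)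
  ultimately have "open N" by simp
  moreover have "v * cnj v = 1"
    using v by (metis complex_norm_square of_real_1 power_one)
  then have "hemi b (Infinity u) \<in> N"
    unfolding u N using r(1) by (simp only: orient_def to_disc.simps v_def if_True one_complex.sel)
  moreover have "inj_on F N"
  proof (rule inj_onI)
    fix p q assume pq: "p \<in> N" "q \<in> N" "F p = F q"
    show "p = q"
    proof (cases rule: mating_sphere_cases[where p = p and c = True])
      case (1 c z)
      then have "F q = hemi c (Finite (poly (f c) z))" using pq(3) by simp
      then obtain w where w: "q = hemi c (Finite w)" "poly (f c) w = poly (f c) z"
        by (rule F_eq_Finite)
      have "z = w"
      proof (rule inj_onD[OF \<epsilon>(2)])
        show "z \<in> {z. Re (to_disc (Finite z) * cnj (orient c v)) > 1 - \<epsilon> c}"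
          using pq(1) r(3)[of c] unfolding 1 N mem_Collect_eq by linarith
        show "w \<in> {z. Re (to_disc (Finite z) * cnj (orient c v)) > 1 - \<epsilon> c}"
          using pq(2) r(3)[of c] unfolding w(1) N mem_Collect_eq by linarith
      qed (simp add: w(2))
      then show ?thesis using 1 w by simp
    next
      case (2 x)
      then have "F q = hemi True (Infinity (circle_power x d))" using pq(3) by simp
      then obtain y where y: "q = hemi True (Infinity y)" "circle_power y d = circle_power x d"
        by (rule F_eq_Infinity)
      have "orient True v = v" by (simp add: orient_def)
      have "circle_val x = circle_val y"
      proof (rule inj_onD[OF \<epsilon>'(2)])
        show "circle_val x ^ d = circle_val y ^ d"
          using y(2) by (metis circle_power.rep_eq)
        show "circle_val x \<in> {a. norm a \<le> 1 \<and> Re (a * cnj v) > 1 - \<epsilon>'}"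
          using pq(1) r(2) unfolding 2 N \<open>orient True v = v\<close> to_disc.simps mem_Collect_eq
          by (simp only: norm_circle_val order_refl simp_thms)
        show "circle_val y \<in> {a. norm a \<le> 1 \<and> Re (a * cnj v) > 1 - \<epsilon>'}"
          using pq(2) r(2) unfolding y(1) N \<open>orient True v = v\<close> to_disc.simps mem_Collect_eq
          by (simp only: norm_circle_val order_refl simp_thms)
      qed
      then show ?thesis using 2 y(1) by (simp add: circle_val_inject)
    qed
  qed
  ultimately show ?thesis
    unfolding critical_points_def by blast
qed

lemma critical_Finite_iff:
  "hemi b (Finite z) \<in> critical_points F \<longleftrightarrow> poly (pderiv (f b)) z = 0"
proof
  assume crit: "hemi b (Finite z) \<in> critical_points F"
  show "poly (pderiv (f b)) z = 0"
  proof (rule ccontr)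
    assume "poly (pderiv (f b)) z \<noteq> 0"
    then have nz: "deriv (poly (f b)) z \<noteq> 0" by (simp add: deriv_poly)
    obtain r where r: "r > 0" "inj_on (poly (f b)) (ball z r)"
      by (rule has_complex_derivative_locally_injective[OF holomorphic_poly UNIV_I open_UNIV nz])
    have "inj_on F (hemi b ` Finite ` ball z r)"
      using r(2) by (auto simp: inj_on_def hemi_eq_iff)
    moreover have "open (hemi b ` Finite ` ball z r)"
      by (rule open_hemi_Finite_image) simp
    moreover have "hemi b (Finite z) \<in> hemi b ` Finite ` ball z r"
      using r(1) by simp
    ultimately show False using crit unfolding critical_points_def by blast
  qed
next
  assume z: "poly (pderiv (f b)) z = 0"
  have "\<not> inj_on F U" if "open U" "hemi b (Finite z) \<in> U" for U
  proof
    assume inj: "inj_on F U"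
    let ?V = "(\<lambda>z. hemi b (Finite z)) -` U"
    have "inj_on (poly (f b)) ?V"
    proof (rule inj_onI)
      fix x y assume "x \<in> ?V" "y \<in> ?V" "poly (f b) x = poly (f b) y"
      then have "hemi b (Finite x) = hemi b (Finite y)"
        using inj_onD[OF inj, of "hemi b (Finite x)" "hemi b (Finite y)"] by simp
      then show "x = y" by (simp add: hemi_eq_iff)
    qed
    moreover have "open ?V"
      using continuous_hemi_Finite that(1) by (rule open_vimage[rotated])
    ultimately have "deriv (poly (f b)) z \<noteq> 0"
      using that(2) by (intro holomorphic_injective_imp_regular[of _ ?V] holomorphic_poly) auto
    then show False using z by (simp add: deriv_poly)
  qed
  then show "hemi b (Finite z) \<in> critical_points F"
    unfolding critical_points_def by blast
qed

lemma Infinity_not_post_critical: "hemi b (Infinity u) \<notin> post_critical_set F"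
proof
  assume "hemi b (Infinity u) \<in> post_critical_set F"
  then obtain n p where p: "p \<in> critical_points F" "(F ^^ n) p = hemi b (Infinity u)"
    unfolding post_critical_set_def by auto
  then show False
    by (cases rule: mating_sphere_cases[where p = p and c = b])
      (auto simp: F_funpow_Finite Infinity_not_critical hemi_eq_iff)
qed

lemma finite_post_critical:
  assumes "post_critically_finite (f b)"
  shows "finite {z. hemi b (Finite z) \<in> post_critical_set F}"
proof -
  have "{z. hemi b (Finite z) \<in> post_critical_set F} \<subseteq>
      (\<Union>n\<in>{1..}. (poly (f b) ^^ n) ` {z. poly (pderiv (f b)) z = 0})"
  proof
    fix z assume "z \<in> {z. hemi b (Finite z) \<in> post_critical_set F}"
    then obtain n p where p: "n \<ge> 1" "p \<in> critical_points F" "(F ^^ n) p = hemi b (Finite z)"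
      unfolding post_critical_set_def by auto
    show "z \<in> (\<Union>n\<in>{1..}. (poly (f b) ^^ n) ` {z. poly (pderiv (f b)) z = 0})"
    proof (cases rule: mating_sphere_cases[where p = p and c = b])
      case (1 c w)
      then have "c = b" "(poly (f b) ^^ n) w = z"
        using p(3) by (auto simp: F_funpow_Finite hemi_eq_iff)
      then show ?thesis using p 1 critical_Finite_iff by auto
    next
      case (2 v)
      then show ?thesis using p Infinity_not_critical by simp
    qed
  qed
  then show ?thesis
    using assms unfolding post_critically_finite_def by (rule finite_subset)
qed

lemma post_critical_forward: "p \<in> post_critical_set F \<Longrightarrow> F p \<in> post_critical_set F"
proof -
  assume "p \<in> post_critical_set F"
  then obtain n q where "n \<ge> 1" "q \<in> critical_points F" "p = (F ^^ n) q"
    unfolding post_critical_set_def by auto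
  then have "F p = (F ^^ Suc n) q" "Suc n \<in> {1..}" by auto
  with \<open>q \<in> critical_points F\<close> show ?thesis
    unfolding post_critical_set_def by blast
qed

lemma F_critical_post_critical: "p \<in> critical_points F \<Longrightarrow> F p \<in> post_critical_set F"
  unfolding post_critical_set_def by (rule UN_I[of 1]) auto

text \<open>A point of the plane outside the post-critical set has no critical preimage, so its preimages are
the simple roots of a polynomial of degree \<open>d\<close>; a point of the equator has \<open>d\<close> preimages as well.\<close>

lemma homotopy_lifting_F: "homotopy_lifting F (- post_critical_set F)"
proof (rule homotopy_lifting_if_constant_fibre_card[OF compact_UNIV_mating_sphere
      continuous_embed_sphere inj_embed_sphere continuous_F d_pos])
  show "\<exists>U. open U \<and> p \<in> U \<and> inj_on F U" if "F p \<in> - post_critical_set F" for p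
    using that F_critical_post_critical unfolding critical_points_def by blast
  show "p \<in> - post_critical_set F" if "F p \<in> - post_critical_set F" for p
    using that post_critical_forward by blast
  show "card {p. F p = y} = d" if y: "y \<in> - post_critical_set F" for y
  proof (cases rule: mating_sphere_cases[where p = y and c = True])
    case (1 b w)
    let ?g = "f b + [:- w:]"
    have "degree ?g = d"
      using deg[of b] d_pos by (simp add: degree_add_eq_left)
    have "poly (pderiv ?g) z \<noteq> 0" if "poly ?g z = 0" for z
    proof -
      have "F (hemi b (Finite z)) = y" using that by (simp add: 1)
      then have "hemi b (Finite z) \<notin> critical_points F"
        using F_critical_post_critical y by blast
      then show ?thesis by (simp add: critical_Finite_iff pderiv_add pderiv_pCons)
    qed
    moreover have "?g \<noteq> 0"
      using \<open>degree ?g = d\<close> d_pos by auto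
    ultimately have "card {z. poly ?g z = 0} = d"
      using card_roots_if_simple \<open>degree ?g = d\<close> by metis
    moreover have "{p. F p = y} = (\<lambda>z. hemi b (Finite z)) ` {z. poly ?g z = 0}"
      unfolding 1 by (auto elim!: F_eq_Finite)
    moreover have "inj_on (\<lambda>z. hemi b (Finite z)) A" for A
      by (simp add: inj_on_def hemi_eq_iff)
    ultimately show ?thesis by (simp add: card_image)
  next
    case (2 v)
    then have "y = equator True (circle_val v)"
      by (simp add: equator_def circle_val_inverse)
    then show ?thesis
      using card_equator_fibre[of "circle_val v" 1 True] by simp
  qed
qed

lemma path_to_equator:
  assumes fin: "\<And>b. post_critically_finite (f b)" and t: "t \<notin> post_critical_set F"
  obtains b v \<alpha> where "norm v = 1" "path \<alpha>" "path_image \<alpha> \<subseteq> - post_critical_set F"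
    "pathstart \<alpha> = t" "pathfinish \<alpha> = equator b v"
proof (cases rule: mating_sphere_cases[where p = t and c = True])
  case (2 u)
  show ?thesis
  proof (rule that)
    show "path (\<lambda>s::real. t)" by (simp add: path_def)
    show "path_image (\<lambda>s::real. t) \<subseteq> - post_critical_set F" using t by (auto simp: path_image_def)
    show "pathfinish (\<lambda>s::real. t) = equator True (circle_val u)"
      by (simp add: pathfinish_def 2 equator_def circle_val_inverse)
  qed (simp_all add: pathstart_def)
next
  case (1 b z)
  \<comment> \<open>The ray from \<open>z\<close> in direction \<open>v\<close> meets \<open>q \<noteq> z\<close> only if \<open>v = sgn (q - z)\<close>.\<close>
  define Q where "Q = {q. hemi b (Finite q) \<in> post_critical_set F}"
  have "finite ((\<lambda>q. sgn (q - z)) ` Q)"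
    using finite_post_critical[OF fin] by (simp add: Q_def)
  then obtain v where v: "norm v = 1" "v \<notin> (\<lambda>q. sgn (q - z)) ` Q"
    using infinite_circle by (metis finite_subset mem_sphere_0 subsetI)
  show ?thesis
  proof (rule that)
    show "path (ray b z v)" using v(1) by (rule path_ray)
    show "path_image (ray b z v) \<subseteq> - post_critical_set F"
    proof
      fix p assume "p \<in> path_image (ray b z v)"
      then obtain s where s: "0 \<le> s" "s \<le> 1" "p = ray b z v s" by (auto simp: path_image_def)
      show "p \<in> - post_critical_set F"
      proof (cases "s < 1")
        case False
        then show ?thesis using s Infinity_not_post_critical by (simp add: ray_def)
      next
        case True
        define q where "q = z + of_real (s / (1 - s)) * v"
        have p: "p = hemi b (Finite q)" using True s by (simp add: ray_def q_def)
        have "q \<notin> Q"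
        proof (cases "s = 0")
          case True
          then show ?thesis using t 1 by (simp add: q_def Q_def)
        next
          case False
          define r where "r = s / (1 - s)"
          have "r > 0" using s True False by (simp add: r_def)
          moreover have "q - z = of_real r * v" by (simp add: q_def r_def)
          ultimately have "sgn (q - z) = v"
            using v(1) by (simp add: sgn_eq norm_mult)
          then show ?thesis using v(2) by blast
        qed
        then show ?thesis using p by (simp add: Q_def)
      qed
    qed
    show "pathstart (ray b z v) = t" by (simp add: pathstart_def ray_def 1)
    show "pathfinish (ray b z v) = equator b v" by (simp add: pathfinish_def ray_def equator_def)
  qed fact
qed

lemma equator_lift:
  assumes w: "norm w = 1"
  shows "is_lift F n (\<lambda>s. equator b (w ^ (d ^ n) * cis (2 * pi * s)))
    (\<lambda>s. equator b (w * cis (2 * pi * s / d ^ n)))"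
proof -
  have "cis (2 * pi * s / d ^ n) ^ (d ^ n) = cis (2 * pi * s)" for s
    unfolding Complex.DeMoivre using d_pos by simp
  moreover have "continuous_on {0..1} (\<lambda>s. equator b (w * cis (2 * pi * s / d ^ n)))"
    using w by (intro continuous_equator continuous_intros) (auto simp: norm_mult d_pos)
  ultimately show ?thesis
    using w by (simp add: is_lift_def path_def F_funpow_equator norm_mult power_mult_distrib)
qed

lemma IMG_odometer:
  assumes fin: "\<And>b. post_critically_finite (f b)" and t: "t \<notin> post_critical_set F"
  shows "\<exists>g \<in> carrier (IMG F t). g \<in> tree_automorphisms F t \<and>
    (\<forall>n. cyclic_on g (tree_level F t n) \<and> card (tree_level F t n) = d ^ n)"
proof -
  obtain b v \<alpha> where v: "norm v = 1" and \<alpha>: "path \<alpha>" "path_image \<alpha> \<subseteq> - post_critical_set F"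
    "pathstart \<alpha> = t" "pathfinish \<alpha> = equator b v"
    using path_to_equator[OF fin t] .
  interpret homotopy_lifting F "- post_critical_set F"
    by (rule homotopy_lifting_F)
  define \<epsilon> where "\<epsilon> = (\<lambda>s::real. equator b (v * cis (2 * pi * s)))"
  define \<rho> where "\<rho> = (\<lambda>n p. equator b (inv_into (sphere 0 1) (equator b) p * cis (2 * pi / d ^ n)))"
  have \<rho>: "\<rho> n (equator b w) = equator b (w * cis (2 * pi / d ^ n))" if "norm w = 1" for n w
    using that by (simp add: \<rho>_def inv_into_f_f[OF inj_on_equator])
  have roots: "norm w = 1" if "w ^ (d ^ n) = v" for w n
    using norm_root_1[OF that v] d_pos by simp
  have "\<exists>g \<in> carrier (IMG F t). g \<in> tree_automorphisms F t \<and>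
    (\<forall>n. cyclic_on g (tree_level F t n) \<and> card (tree_level F t n) = card {y. (F ^^ n) y = equator b v})"
  proof (rule IMG_contains_odometer[OF \<alpha>])
    show "path \<epsilon>"
      unfolding path_def \<epsilon>_def using v by (intro continuous_equator continuous_intros) (simp add: norm_mult)
    show "path_image \<epsilon> \<subseteq> - post_critical_set F"
      using Infinity_not_post_critical by (auto simp: path_image_def \<epsilon>_def equator_def)
    show "pathstart \<epsilon> = equator b v" "pathfinish \<epsilon> = equator b v"
      by (simp_all add: pathstart_def pathfinish_def \<epsilon>_def)
    show "\<exists>\<delta>. is_lift F n \<epsilon> \<delta> \<and> pathstart \<delta> = y \<and> pathfinish \<delta> = \<rho> n y"
      if y: "(F ^^ n) y = equator b v" for n y
    proof -
      obtain w where w: "y = equator b w" "w ^ (d ^ n) = v"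
        using y equator_fibre[OF v] by blast
      have "is_lift F n \<epsilon> (\<lambda>s. equator b (w * cis (2 * pi * s / d ^ n)))"
        using equator_lift[OF roots[OF w(2)], of n b] unfolding \<epsilon>_def w(2) .
      then show ?thesis
        using \<rho>[OF roots[OF w(2)]] w(1)
        by (intro exI[of _ "\<lambda>s. equator b (w * cis (2 * pi * s / d ^ n))"])
          (simp add: pathstart_def pathfinish_def)
    qed
    show "cyclic_on (\<rho> n) {y. (F ^^ n) y = equator b v}" for n
      unfolding equator_fibre[OF v]
    proof (rule cyclic_on_image)
      show "cyclic_on (\<lambda>w. w * cis (2 * pi / real (d ^ n))) {w. w ^ (d ^ n) = v}"
        using v d_pos by (intro cyclic_on_roots) auto
      show "\<rho> n (equator b w) = equator b (w * cis (2 * pi / real (d ^ n)))"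
        if "w \<in> {w. w ^ (d ^ n) = v}" for w
        using that \<rho> roots by simp
    qed
  qed simp
  then show ?thesis
    by (simp add: card_equator_fibre[OF v])
qed

end

section \<open>The cyclic automorphism\<close>

theorem proposition6:
  fixes d :: nat and f1 f2 :: "complex poly" and t :: mating_sphere
  assumes "d \<ge> 2"
    and "degree f1 = d" and "degree f2 = d"
    and "lead_coeff f1 = 1" and "lead_coeff f2 = 1"
    and "post_critically_finite f1" and "post_critically_finite f2"
    and "t \<notin> post_critical_set (formal_mating d f1 f2)"
  shows "\<exists>g \<in> carrier (IMG (formal_mating d f1 f2) t).
           g \<in> carrier (tree_Aut (formal_mating d f1 f2) t) \<and>
           (\<forall>n\<ge>1. cyclic_on g (tree_level (formal_mating d f1 f2) t n) \<and>
                  card (tree_level (formal_mating d f1 f2) t n) = d ^ n)"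
proof -
  interpret monic_mating d "\<lambda>b. if b then f1 else f2"
    using assms by unfold_locales auto
  have F: "F = formal_mating d f1 f2"
    by (simp add: F_def)
  have "\<exists>g \<in> carrier (IMG F t). g \<in> tree_automorphisms F t \<and>
      (\<forall>n. cyclic_on g (tree_level F t n) \<and> card (tree_level F t n) = d ^ n)"
    using assms F by (intro IMG_odometer) auto
  then show ?thesis
    unfolding F by (auto simp: tree_Aut_def)
qed

end
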